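(* Let $\Omega\subset\mathbb{R}^d$ be a bounded open set and let $f\in L^2(\Omega)$. Then, for every $p<0$, the problem $$\min\Big\{E_f(V)\ :\ V:\Omega\to[0,+\infty]\text{ measurable},\ \int_\Omega V^p\,dx=1\Big\}$$ has a solution.
   Context: For a potential $V:\Omega\to[0,+\infty]$, the Dirichlet energy is $$E_f(V)=\min_{u\in H^1_0(\Omega)}\ \frac12\int_\Omega|\nabla u|^2\,dx+\frac12\int_\Omega u^2V\,dx-\int_\Omega uf\,dx,$$ where $H^1_0(\Omega)$ is the usual Sobolev space. Conventions: for $p<0$, $0^p=+\infty$ and $(+\infty)^p=0$; in the product $u^2V$, $0\cdot(+\infty)=0$ (so the integral $\int_\Omega u^2V\,dx$ takes values in $[0,+\infty]$). *)

theory Defs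
  imports "HOL-Analysis.Analysis"
begin

definition L2_on :: "'a::euclidean_space set \<Rightarrow> ('a \<Rightarrow> 'b::euclidean_space) \<Rightarrow> bool" where
  "L2_on \<Omega> u \<longleftrightarrow> u \<in> borel_measurable (lebesgue_on \<Omega>) \<and>
     integrable (lebesgue_on \<Omega>) (\<lambda>x. (norm (u x))\<^sup>2)"

abbreviation partial_deriv :: "'a::euclidean_space \<Rightarrow> ('a \<Rightarrow> real) \<Rightarrow> 'a \<Rightarrow> real" where
  "partial_deriv i \<phi> x \<equiv> frechet_derivative \<phi> (at x) i"

definition grad :: "('a::euclidean_space \<Rightarrow> real) \<Rightarrow> 'a \<Rightarrow> 'a" where
  "grad \<phi> x = (\<Sum>i\<in>Basis. partial_deriv i \<phi> x *\<^sub>R i)"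

primrec C_k :: "nat \<Rightarrow> ('a::euclidean_space \<Rightarrow> real) \<Rightarrow> bool" where
  "C_k 0 \<phi> \<longleftrightarrow> continuous_on UNIV \<phi>"
| "C_k (Suc k) \<phi> \<longleftrightarrow> (\<forall>x. \<phi> differentiable (at x)) \<and> (\<forall>i\<in>Basis. C_k k (partial_deriv i \<phi>))"

text \<open>The space \<open>C\<^sub>c\<^sup>\<infinity>(\<Omega>)\<close>; its elements are extended by \<open>0\<close> outside \<open>\<Omega>\<close>.\<close>

definition test_functions :: "'a::euclidean_space set \<Rightarrow> ('a \<Rightarrow> real) set" where
  "test_functions \<Omega> =
     {\<phi>. (\<forall>k. C_k k \<phi>) \<and> compact (closure {x. \<phi> x \<noteq> 0}) \<and> closure {x. \<phi> x \<noteq> 0} \<subseteq> \<Omega>}"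

definition weak_gradient_on ::
    "'a::euclidean_space set \<Rightarrow> ('a \<Rightarrow> real) \<Rightarrow> ('a \<Rightarrow> 'a) \<Rightarrow> bool" where
  "weak_gradient_on \<Omega> u Du \<longleftrightarrow>
     (\<forall>\<phi>\<in>test_functions \<Omega>. \<forall>i\<in>Basis.
        (LINT x|lebesgue_on \<Omega>. u x * partial_deriv i \<phi> x) =
        - (LINT x|lebesgue_on \<Omega>. (Du x \<bullet> i) * \<phi> x))"

text \<open>\<open>H\<^sup>1(\<Omega>)\<close> and \<open>H\<^sup>1\<^sub>0(\<Omega>)\<close>. Functions are representatives of their a.e. classes, and an element
  \<open>u\<close> is recorded together with (a representative of) its weak gradient \<open>Du\<close>, which is determined
  a.e. by \<open>u\<close>. \<open>H\<^sup>1\<^sub>0(\<Omega>)\<close> is the closure of \<open>C\<^sub>c\<^sup>\<infinity>(\<Omega>)\<close> in the \<open>H\<^sup>1\<close> norm.\<close>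

definition H1 :: "'a::euclidean_space set \<Rightarrow> (('a \<Rightarrow> real) \<times> ('a \<Rightarrow> 'a)) set" where
  "H1 \<Omega> = {(u, Du). L2_on \<Omega> u \<and> L2_on \<Omega> Du \<and> weak_gradient_on \<Omega> u Du}"

definition H10 :: "'a::euclidean_space set \<Rightarrow> (('a \<Rightarrow> real) \<times> ('a \<Rightarrow> 'a)) set" where
  "H10 \<Omega> = {(u, Du) \<in> H1 \<Omega>. \<exists>\<phi>::nat \<Rightarrow> 'a \<Rightarrow> real. (\<forall>n. \<phi> n \<in> test_functions \<Omega>) \<and>
     (\<lambda>n. sqrt ((LINT x|lebesgue_on \<Omega>. (\<phi> n x - u x)\<^sup>2) +
                (LINT x|lebesgue_on \<Omega>. (norm (grad (\<phi> n) x - Du x))\<^sup>2))) \<longlonglongrightarrow> 0}"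

text \<open>In \<open>ennreal\<close>, \<open>0 * \<infinity> = 0\<close>, as required in the product \<open>u\<^sup>2 V\<close>.\<close>

definition energy_functional ::
    "'a::euclidean_space set \<Rightarrow> ('a \<Rightarrow> real) \<Rightarrow> ('a \<Rightarrow> ennreal) \<Rightarrow> ('a \<Rightarrow> real) \<Rightarrow> ('a \<Rightarrow> 'a) \<Rightarrow> ereal" where
  "energy_functional \<Omega> f V u Du =
     ereal (1/2 * (LINT x|lebesgue_on \<Omega>. (norm (Du x))\<^sup>2))
     + ereal (1/2) * enn2ereal (\<integral>\<^sup>+x. ennreal ((u x)\<^sup>2) * V x \<partial>lebesgue_on \<Omega>)
     - ereal (LINT x|lebesgue_on \<Omega>. u x * f x)"

text \<open>The minimum over \<open>H\<^sup>1\<^sub>0(\<Omega>)\<close>, taken as an infimum in \<open>ereal\<close>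
  (for bounded open \<open>\<Omega>\<close> and \<open>f \<in> L\<^sup>2(\<Omega>)\<close> it is attained).\<close>

definition dirichlet_energy ::
    "'a::euclidean_space set \<Rightarrow> ('a \<Rightarrow> real) \<Rightarrow> ('a \<Rightarrow> ennreal) \<Rightarrow> ereal" where
  "dirichlet_energy \<Omega> f V = (INF (u, Du)\<in>H10 \<Omega>. energy_functional \<Omega> f V u Du)"

text \<open>The power \<open>v\<^sup>p\<close> on \<open>[0,\<infinity>]\<close> for negative exponents \<open>p\<close>.\<close>

definition ennreal_neg_powr :: "ennreal \<Rightarrow> real \<Rightarrow> ennreal" where
  "ennreal_neg_powr v p =
     (if v = 0 then \<infinity> else if v = \<infinity> then 0 else ennreal (enn2real v powr p))"

definition admissible_potentials :: "'a::euclidean_space set \<Rightarrow> real \<Rightarrow> ('a \<Rightarrow> ennreal) set" where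
  "admissible_potentials \<Omega> p =
     {V. V \<in> borel_measurable (lebesgue_on \<Omega>) \<and>
         (\<integral>\<^sup>+x. ennreal_neg_powr (V x) p \<partial>lebesgue_on \<Omega>) = 1}"

end

theory Submission
  imports Defs "HOL-Complex_Analysis.Great_Picard"
begin

text \<open>
  Put \<open>s = -p\<close> and \<open>q = 2s/(s+1)\<close>. For fixed \<open>u\<close> the minimum of \<open>\<integral>u\<^sup>2V\<close> under the constraint
  \<open>\<integral>V\<^sup>p = 1\<close> equals \<open>(\<integral>|u|\<^sup>q)\<^bsup>1+1/s\<^esup>\<close> and is attained where \<open>V\<^sup>p\<close> is proportional to \<open>|u|\<^sup>q\<close>.
  Exchanging the two infima, it suffices to minimise
  \<open>1/2 \<integral>|\<nabla>u|\<^sup>2 + 1/2 (\<integral>|u|\<^sup>q)\<^bsup>1+1/s\<^esup> - \<integral>uf\<close> over \<open>H\<^sup>1\<^sub>0(\<Omega>)\<close>. For \<open>q < 1\<close> this functional is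
  not convex, so a minimising sequence is made to converge in \<open>L\<^sup>2\<close> and almost everywhere by
  Rellich's theorem; Fatou's lemma then handles the middle term. Both Rellich's theorem and
  Poincare's inequality come from the translation estimate
  \<open>\<integral>|\<phi>(x+h) - \<phi>(x)|\<^sup>2 \<le> |h|\<^sup>2 \<integral>|\<nabla>\<phi>|\<^sup>2\<close> for test functions.
\<close>

section \<open>Square-integrable functions\<close>

text \<open>The exponents come from the stationarity condition of
  \<open>r^2 * w + mu * w^(-s)\<close> in \<open>w\<close>, namely
  \<open>r^2 = s * mu * w^(-s-1)\<close>: the optimal \<open>w\<close> is proportional to
  \<open>r^(-2/(s+1))\<close>, so \<open>w^(-s)\<close> is proportional to \<open>r^q\<close>, and
  \<open>1 + 1/s = 2/q\<close> makes the reduced middle term the square of the \<open>L^q\<close>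
  (quasi-)norm. The values 0 and infinity of \<open>V\<close> force the case distinctions: a zero of
  \<open>u\<close> gets an infinite potential, and \<open>u = 0\<close> a.e. leaves nothing to
  normalise. No minimiser of the inner problem has to be produced: the Dirichlet energy is an
  infimum, so one competitor bounds it from above, while lower bounds are checked on every
  competitor. The gradients of a minimising sequence only stay bounded. Instead of a weak limit, a
  second minimisation, over nearby functions, yields a strongly convergent sequence of gradients.
  Estimates are made for squared norms, at the price of factors of 2, and Cauchy-Schwarz for
  pairings of two functions appears as Young's inequality with a free parameter.\<close>

definition sqnorm :: "'a::euclidean_space set \<Rightarrow> ('a \<Rightarrow> 'b::euclidean_space) \<Rightarrow> real" where
  "sqnorm \<Omega> u = (LINT x|lebesgue_on \<Omega>. (norm (u x))\<^sup>2)"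

text \<open>Stands in for the triangle inequality, so that only squared norms occur; its factors of
  2 explain the accuracies \<open>e/4\<close> and \<open>e/10\<close> in later estimates.\<close>

lemma norm_add_sq_le: "(norm (a + b))\<^sup>2 \<le> 2 * (norm a)\<^sup>2 + 2 * (norm (b::'a::real_inner))\<^sup>2"
proof -
  have "0 \<le> (norm (a - b))\<^sup>2" by simp
  then show ?thesis
    by (simp add: power2_norm_eq_inner algebra_simps inner_commute)
qed

lemma L2_on_measurable: "L2_on \<Omega> u \<Longrightarrow> u \<in> borel_measurable (lebesgue_on \<Omega>)"
  by (simp add: L2_on_def)

lemma L2_on_integrable: "L2_on \<Omega> u \<Longrightarrow> integrable (lebesgue_on \<Omega>) (\<lambda>x. (norm (u x))\<^sup>2)"
  by (simp add: L2_on_def)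

lemma L2_on_dominated:
  assumes "integrable (lebesgue_on \<Omega>) g" "u \<in> borel_measurable (lebesgue_on \<Omega>)"
    and "\<And>x. (norm (u x))\<^sup>2 \<le> g x"
  shows "L2_on \<Omega> u"
  unfolding L2_on_def
proof
  show "integrable (lebesgue_on \<Omega>) (\<lambda>x. (norm (u x))\<^sup>2)"
    using assms(2,3) by (intro Bochner_Integration.integrable_bound[OF assms(1)])
      (auto intro: order_trans[OF _ abs_ge_self])
qed fact

lemma L2_on_zero: "L2_on \<Omega> (\<lambda>x. 0)"
  by (simp add: L2_on_def)

lemma L2_on_scaleR:
  assumes "L2_on \<Omega> u" shows "L2_on \<Omega> (\<lambda>x. c *\<^sub>R u x)"
proof -
  note [measurable] = L2_on_measurable[OF assms]
  show ?thesis using L2_on_integrable[OF assms]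
    by (simp add: L2_on_def power_mult_distrib)
qed

lemma L2_on_add:
  assumes "L2_on \<Omega> u" "L2_on \<Omega> v" shows "L2_on \<Omega> (\<lambda>x. u x + v x)"
proof (rule L2_on_dominated)
  note [measurable] = L2_on_measurable[OF assms(1)] L2_on_measurable[OF assms(2)]
  show "(\<lambda>x. u x + v x) \<in> borel_measurable (lebesgue_on \<Omega>)" by measurable
  show "integrable (lebesgue_on \<Omega>) (\<lambda>x. 2 * (norm (u x))\<^sup>2 + 2 * (norm (v x))\<^sup>2)"
    using assms by (simp add: L2_on_integrable)
qed (rule norm_add_sq_le)

lemma L2_on_diff:
  assumes "L2_on \<Omega> u" "L2_on \<Omega> v" shows "L2_on \<Omega> (\<lambda>x. u x - v x)"
  using L2_on_add[OF assms(1) L2_on_scaleR[OF assms(2), of "-1"]] by simp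

lemma L2_on_inner_right:
  assumes "L2_on \<Omega> u" shows "L2_on \<Omega> (\<lambda>x. u x \<bullet> i)"
proof (rule L2_on_dominated)
  note [measurable] = L2_on_measurable[OF assms]
  show "(\<lambda>x. u x \<bullet> i) \<in> borel_measurable (lebesgue_on \<Omega>)" by measurable
  show "integrable (lebesgue_on \<Omega>) (\<lambda>x. (norm i)\<^sup>2 * (norm (u x))\<^sup>2)"
    using assms by (simp add: L2_on_integrable)
  show "(norm (u x \<bullet> i))\<^sup>2 \<le> (norm i)\<^sup>2 * (norm (u x))\<^sup>2" for x
    using power_mono[OF Cauchy_Schwarz_ineq2[of "u x" i], of 2]
    by (simp add: power_mult_distrib mult.commute)
qed

lemma sqnorm_nonneg: "0 \<le> sqnorm \<Omega> u"
  by (simp add: sqnorm_def)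

lemma sqnorm_zero [simp]: "sqnorm \<Omega> (\<lambda>x. 0) = 0"
  by (simp add: sqnorm_def)

lemma sqnorm_scaleR: "sqnorm \<Omega> (\<lambda>x. c *\<^sub>R u x) = c\<^sup>2 * sqnorm \<Omega> u"
  by (simp add: sqnorm_def power_mult_distrib)

lemma sqnorm_minus_commute: "sqnorm \<Omega> (\<lambda>x. u x - v x) = sqnorm \<Omega> (\<lambda>x. v x - u x)"
  by (simp add: sqnorm_def norm_minus_commute)

lemma sqnorm_add_le:
  assumes "L2_on \<Omega> u" "L2_on \<Omega> v"
  shows "sqnorm \<Omega> (\<lambda>x. u x + v x) \<le> 2 * sqnorm \<Omega> u + 2 * sqnorm \<Omega> v"
proof -
  have "sqnorm \<Omega> (\<lambda>x. u x + v x) \<le> (LINT x|lebesgue_on \<Omega>. 2 * (norm (u x))\<^sup>2 + 2 * (norm (v x))\<^sup>2)"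
    unfolding sqnorm_def using assms L2_on_integrable[OF L2_on_add[OF assms]]
    by (intro integral_mono norm_add_sq_le) (auto simp: L2_on_integrable)
  also have "\<dots> = 2 * sqnorm \<Omega> u + 2 * sqnorm \<Omega> v"
    using assms by (simp add: sqnorm_def L2_on_integrable)
  finally show ?thesis .
qed

lemma sqnorm_diff_le:
  assumes "L2_on \<Omega> u" "L2_on \<Omega> v" "L2_on \<Omega> w"
  shows "sqnorm \<Omega> (\<lambda>x. u x - w x) \<le> 2 * sqnorm \<Omega> (\<lambda>x. u x - v x) + 2 * sqnorm \<Omega> (\<lambda>x. v x - w x)"
  using sqnorm_add_le[OF L2_on_diff[OF assms(1,2)] L2_on_diff[OF assms(2,3)]] by simp

lemma sqnorm_parallelogram:
  assumes "L2_on \<Omega> u" "L2_on \<Omega> v"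
  shows "sqnorm \<Omega> (\<lambda>x. u x - v x) =
    2 * sqnorm \<Omega> u + 2 * sqnorm \<Omega> v - 4 * sqnorm \<Omega> (\<lambda>x. (1/2) *\<^sub>R (u x + v x))"
proof -
  have "4 * sqnorm \<Omega> (\<lambda>x. (1/2) *\<^sub>R (u x + v x)) = sqnorm \<Omega> (\<lambda>x. u x + v x)"
    unfolding sqnorm_scaleR by (simp add: power2_eq_square)
  moreover have "sqnorm \<Omega> (\<lambda>x. u x + v x) + sqnorm \<Omega> (\<lambda>x. u x - v x) = 2 * sqnorm \<Omega> u + 2 * sqnorm \<Omega> v"
  proof -
    have "sqnorm \<Omega> (\<lambda>x. u x + v x) + sqnorm \<Omega> (\<lambda>x. u x - v x)
      = (LINT x|lebesgue_on \<Omega>. (norm (u x + v x))\<^sup>2 + (norm (u x - v x))\<^sup>2)"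
      unfolding sqnorm_def
      using L2_on_integrable[OF L2_on_add[OF assms]] L2_on_integrable[OF L2_on_diff[OF assms]] by simp
    also have "\<dots> = (LINT x|lebesgue_on \<Omega>. 2 * (norm (u x))\<^sup>2 + 2 * (norm (v x))\<^sup>2)"
      by (intro Bochner_Integration.integral_cong)
         (auto simp: power2_norm_eq_inner algebra_simps inner_commute)
    also have "\<dots> = 2 * sqnorm \<Omega> u + 2 * sqnorm \<Omega> v"
      using assms by (simp add: sqnorm_def L2_on_integrable)
    finally show ?thesis .
  qed
  ultimately show ?thesis by simp
qed

text \<open>The parallelogram law for \<open>u - w\<close> and \<open>v - w\<close>, with the
  nonnegative square of their difference dropped. It makes \<open>L^2\<close> balls around
  \<open>w\<close> closed under midpoints, as the gradient argument requires.\<close>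

lemma sqnorm_midpoint_le:
  assumes "L2_on \<Omega> u" "L2_on \<Omega> v" "L2_on \<Omega> w"
  shows "sqnorm \<Omega> (\<lambda>x. (1/2) *\<^sub>R (u x + v x) - w x) \<le>
    (sqnorm \<Omega> (\<lambda>x. u x - w x) + sqnorm \<Omega> (\<lambda>x. v x - w x)) / 2"
proof -
  have *: "(1/2) *\<^sub>R (u x + v x) - w x = (1/2) *\<^sub>R ((u x - w x) + (v x - w x))" for x
    by (simp add: algebra_simps flip: scaleR_add_left)
  show ?thesis
    using sqnorm_parallelogram[OF L2_on_diff[OF assms(1,3)] L2_on_diff[OF assms(2,3)]]
      sqnorm_nonneg[of \<Omega> "\<lambda>x. (u x - w x) - (v x - w x)"]
    unfolding * by simp
qed

text \<open>From \<open>(t |a| - |b|)^2 / t >= 0\<close>. The parameter \<open>t\<close> is later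
  tuned either to make the \<open>b\<close> term small or to absorb the \<open>a\<close>
  term.\<close>

lemma abs_inner_le_young:
  fixes a b :: "'a::real_inner"
  assumes "t > 0" shows "\<bar>a \<bullet> b\<bar> \<le> t * (norm a)\<^sup>2 + (norm b)\<^sup>2 / t"
proof -
  have "0 \<le> (t * norm a - norm b)\<^sup>2 / t" using assms by simp
  also have "\<dots> = t * (norm a)\<^sup>2 + (norm b)\<^sup>2 / t - 2 * (norm a * norm b)"
    using assms by (simp add: power2_eq_square field_simps)
  finally have "norm a * norm b \<le> t * (norm a)\<^sup>2 + (norm b)\<^sup>2 / t"
    using mult_nonneg_nonneg[OF norm_ge_zero[of a] norm_ge_zero[of b]] by linarith
  then show ?thesis using Cauchy_Schwarz_ineq2[of a b] by linarith
qed

lemma L2_on_inner_integrable: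
  assumes "L2_on \<Omega> u" "L2_on \<Omega> v" shows "integrable (lebesgue_on \<Omega>) (\<lambda>x. u x \<bullet> v x)"
proof (rule Bochner_Integration.integrable_bound)
  note [measurable] = L2_on_measurable[OF assms(1)] L2_on_measurable[OF assms(2)]
  show "integrable (lebesgue_on \<Omega>) (\<lambda>x. (norm (u x))\<^sup>2 + (norm (v x))\<^sup>2)"
    using assms by (simp add: L2_on_integrable)
  show "(\<lambda>x. u x \<bullet> v x) \<in> borel_measurable (lebesgue_on \<Omega>)" by measurable
  show "AE x in lebesgue_on \<Omega>. norm (u x \<bullet> v x) \<le> norm ((norm (u x))\<^sup>2 + (norm (v x))\<^sup>2)"
    using abs_inner_le_young[of 1] by auto
qed

lemma L2_on_integral_inner_le:
  assumes "L2_on \<Omega> u" "L2_on \<Omega> v" "t > 0"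
  shows "\<bar>LINT x|lebesgue_on \<Omega>. u x \<bullet> v x\<bar> \<le> t * sqnorm \<Omega> u + sqnorm \<Omega> v / t"
proof -
  have "\<bar>LINT x|lebesgue_on \<Omega>. u x \<bullet> v x\<bar> \<le> (LINT x|lebesgue_on \<Omega>. \<bar>u x \<bullet> v x\<bar>)"
    by (rule integral_abs_bound)
  also have "\<dots> \<le> (LINT x|lebesgue_on \<Omega>. t * (norm (u x))\<^sup>2 + (norm (v x))\<^sup>2 / t)"
    using assms L2_on_inner_integrable[OF assms(1,2)]
    by (intro integral_mono abs_inner_le_young) (auto simp: L2_on_integrable)
  also have "\<dots> = t * sqnorm \<Omega> u + sqnorm \<Omega> v / t"
    using assms by (simp add: sqnorm_def L2_on_integrable)
  finally show ?thesis .
qed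

lemma L2_on_integral_inner_tendsto:
  assumes "\<And>n. L2_on \<Omega> (v n)" "L2_on \<Omega> u" "L2_on \<Omega> w"
    and lim: "(\<lambda>n. sqnorm \<Omega> (\<lambda>x. v n x - u x)) \<longlonglongrightarrow> 0"
  shows "(\<lambda>n. LINT x|lebesgue_on \<Omega>. v n x \<bullet> w x) \<longlonglongrightarrow> (LINT x|lebesgue_on \<Omega>. u x \<bullet> w x)"
proof (rule LIMSEQ_I)
  fix e :: real assume "e > 0"
  \<comment> \<open>Large enough that the fixed factor \<open>w\<close> contributes less than
    \<open>e/2\<close>; the \<open>+ 1\<close> keeps \<open>t\<close> positive when \<open>w\<close>
    vanishes.\<close>
  define t where "t = 2 * (sqnorm \<Omega> w + 1) / e"
  have t: "t > 0" using \<open>e > 0\<close> sqnorm_nonneg[of \<Omega> w] by (simp add: t_def)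
  have te: "sqnorm \<Omega> w / t < e / 2"
    using \<open>e > 0\<close> sqnorm_nonneg[of \<Omega> w] by (simp add: t_def field_simps)
  have "\<forall>\<^sub>F n in sequentially. sqnorm \<Omega> (\<lambda>x. v n x - u x) < e / (2 * t)"
    using order_tendstoD(2)[OF lim, of "e / (2*t)"] \<open>e > 0\<close> t by simp
  then obtain N where N: "\<And>n. n \<ge> N \<Longrightarrow> sqnorm \<Omega> (\<lambda>x. v n x - u x) < e / (2 * t)"
    by (auto simp: eventually_sequentially)
  show "\<exists>N. \<forall>n\<ge>N. norm ((LINT x|lebesgue_on \<Omega>. v n x \<bullet> w x) - (LINT x|lebesgue_on \<Omega>. u x \<bullet> w x)) < e"
  proof (intro exI allI impI)
    fix n assume "n \<ge> N"
    have "(LINT x|lebesgue_on \<Omega>. v n x \<bullet> w x) - (LINT x|lebesgue_on \<Omega>. u x \<bullet> w x)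
       = (LINT x|lebesgue_on \<Omega>. (v n x - u x) \<bullet> w x)"
      using assms by (simp add: inner_diff_left L2_on_inner_integrable)
    also have "\<bar>\<dots>\<bar> \<le> t * sqnorm \<Omega> (\<lambda>x. v n x - u x) + sqnorm \<Omega> w / t"
      using assms t by (intro L2_on_integral_inner_le L2_on_diff) auto
    also have "\<dots> < t * (e / (2 * t)) + e / 2"
      using N[OF \<open>n \<ge> N\<close>] t te by (intro add_strict_mono mult_strict_left_mono) auto
    also have "\<dots> = e" using t by simp
    finally show "norm ((LINT x|lebesgue_on \<Omega>. v n x \<bullet> w x) - (LINT x|lebesgue_on \<Omega>. u x \<bullet> w x)) < e"
      by simp
  qed
qed

section \<open>Fatou's lemma and completeness for square-integrable functions\<close>

lemma nn_integral_norm_sq: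
  assumes "L2_on \<Omega> u"
  shows "(\<integral>\<^sup>+x. ennreal ((norm (u x))\<^sup>2) \<partial>lebesgue_on \<Omega>) = ennreal (sqnorm \<Omega> u)"
  unfolding sqnorm_def using assms by (intro nn_integral_eq_integral) (auto simp: L2_on_integrable)

lemma L2_on_nn_integralI:
  assumes [measurable]: "u \<in> borel_measurable (lebesgue_on \<Omega>)"
    and le: "(\<integral>\<^sup>+x. ennreal ((norm (u x))\<^sup>2) \<partial>lebesgue_on \<Omega>) \<le> ennreal c" and c: "c \<ge> 0"
  shows "L2_on \<Omega> u" and "sqnorm \<Omega> u \<le> c"
proof -
  have "integrable (lebesgue_on \<Omega>) (\<lambda>x. (norm (u x))\<^sup>2)"
    using order_le_less_trans[OF le ennreal_less_top] by (intro integrableI_bounded) auto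
  then show L2: "L2_on \<Omega> u" by (simp add: L2_on_def)
  show "sqnorm \<Omega> u \<le> c"
    using le c unfolding nn_integral_norm_sq[OF L2] by (simp add: ennreal_le_iff)
qed

text \<open>Fatou's lemma. Integrability of the limit is part of the conclusion, so the limit
  function need only be measurable beforehand.\<close>

lemma AE_liminf_sqnorm_le:
  assumes L2: "\<And>n. L2_on \<Omega> (v n)" and [measurable]: "u \<in> borel_measurable (lebesgue_on \<Omega>)"
    and AE: "AE x in lebesgue_on \<Omega>. (\<lambda>n. v n x) \<longlonglongrightarrow> u x"
    and le: "\<forall>\<^sub>F n in sequentially. sqnorm \<Omega> (v n) \<le> c" and c: "c \<ge> 0"
  shows "L2_on \<Omega> u" and "sqnorm \<Omega> u \<le> c"
proof -
  note [measurable] = L2_on_measurable[OF L2]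
  have "(\<integral>\<^sup>+x. ennreal ((norm (u x))\<^sup>2) \<partial>lebesgue_on \<Omega>)
      = (\<integral>\<^sup>+x. liminf (\<lambda>n. ennreal ((norm (v n x))\<^sup>2)) \<partial>lebesgue_on \<Omega>)"
  proof (rule nn_integral_cong_AE, use AE in eventually_elim)
    fix x assume "(\<lambda>n. v n x) \<longlonglongrightarrow> u x"
    then have "(\<lambda>n. ennreal ((norm (v n x))\<^sup>2)) \<longlonglongrightarrow> ennreal ((norm (u x))\<^sup>2)"
      by (intro tendsto_ennrealI tendsto_intros)
    then show "ennreal ((norm (u x))\<^sup>2) = liminf (\<lambda>n. ennreal ((norm (v n x))\<^sup>2))"
      by (metis lim_imp_Liminf sequentially_bot)
  qed
  also have "\<dots> \<le> liminf (\<lambda>n. \<integral>\<^sup>+x. ennreal ((norm (v n x))\<^sup>2) \<partial>lebesgue_on \<Omega>)"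
    by (intro nn_integral_liminf) measurable
  also have "\<dots> = liminf (\<lambda>n. ennreal (sqnorm \<Omega> (v n)))"
    by (simp add: nn_integral_norm_sq[OF L2])
  also have "\<dots> \<le> limsup (\<lambda>n. ennreal (sqnorm \<Omega> (v n)))"
    by (intro Liminf_le_Limsup) simp
  also have "\<dots> \<le> ennreal c"
    using le by (intro Limsup_bounded) (auto elim!: eventually_mono intro: ennreal_leI)
  finally have *: "(\<integral>\<^sup>+x. ennreal ((norm (u x))\<^sup>2) \<partial>lebesgue_on \<Omega>) \<le> ennreal c" .
  show "L2_on \<Omega> u" "sqnorm \<Omega> u \<le> c" using L2_on_nn_integralI[OF _ * c] by auto
qed

text \<open>Riesz-Fischer. Along a subsequence with squared increments at most
  \<open>(1/4)^j\<close> the increments are summable in \<open>L^1\<close>, because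
  \<open>\<Omega>\<close> has finite measure; so it converges a.e., and Fatou's lemma carries the
  Cauchy estimates to the limit. The subsequence \<open>k\<close> is returned because later Fatou
  arguments need pointwise convergence.\<close>

lemma L2_complete:
  fixes v :: "nat \<Rightarrow> 'a::euclidean_space \<Rightarrow> 'b::euclidean_space"
  assumes fin: "emeasure lebesgue \<Omega> < \<infinity>" and \<Omega>: "\<Omega> \<in> sets lebesgue"
    and L2: "\<And>n. L2_on \<Omega> (v n)"
    and Cauchy: "\<And>e. e > 0 \<Longrightarrow> \<exists>N. \<forall>m\<ge>N. \<forall>n\<ge>N. sqnorm \<Omega> (\<lambda>x. v m x - v n x) \<le> e"
  obtains u k where "L2_on \<Omega> u" "(\<lambda>n. sqnorm \<Omega> (\<lambda>x. v n x - u x)) \<longlonglongrightarrow> 0"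
    "strict_mono (k::nat\<Rightarrow>nat)" "AE x in lebesgue_on \<Omega>. (\<lambda>n. v (k n) x) \<longlonglongrightarrow> u x"
proof -
  note [measurable] = L2_on_measurable[OF L2]
  let ?M = "lebesgue_on \<Omega>"
  have finM: "emeasure ?M (space ?M) < \<infinity>"
    using fin \<Omega> by (simp add: emeasure_restrict_space)
  define \<mu> where "\<mu> = measure ?M (space ?M)"
  have "\<exists>N. \<forall>m\<ge>N. \<forall>n\<ge>N. sqnorm \<Omega> (\<lambda>x. v m x - v n x) \<le> (1/4)^j" for j
    using Cauchy[of "(1/4)^j"] by simp
  then obtain N where N: "\<And>j m n. m \<ge> N j \<Longrightarrow> n \<ge> N j \<Longrightarrow> sqnorm \<Omega> (\<lambda>x. v m x - v n x) \<le> (1/4)^j"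
    by metis
  define k where "k = rec_nat (N 0) (\<lambda>j kj. max (Suc kj) (N (Suc j)))"
  have k0: "k 0 = N 0" and kS: "k (Suc j) = max (Suc (k j)) (N (Suc j))" for j
    by (simp_all add: k_def)
  have k: "strict_mono k" by (intro strict_monoI_Suc) (simp add: kS)
  have kN: "k j \<ge> N j" for j by (cases j) (simp_all add: k0 kS)
  define d where "d j x = v (k (Suc j)) x - v (k j) x" for j x
  have d_L2: "L2_on \<Omega> (d j)" for j unfolding d_def by (intro L2_on_diff L2)
  note [measurable] = L2_on_measurable[OF d_L2]
  have d_sq: "sqnorm \<Omega> (d j) \<le> (1/4)^j" for j
    unfolding d_def using kN[of j] strict_monoD[OF k, of j "Suc j"] by (intro N) auto
  have d_L1: "(\<integral>\<^sup>+x. ennreal (norm (d j x)) \<partial>?M) \<le> ennreal ((1 + \<mu>) * (1/2)^j)" for j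
  proof -
    have "(\<integral>\<^sup>+x. ennreal (norm (d j x)) \<partial>?M)
        \<le> (\<integral>\<^sup>+x. ennreal (2^j) * ennreal ((norm (d j x))\<^sup>2) + ennreal ((1/2)^j) \<partial>?M)"
    proof (rule nn_integral_mono)
      fix x
      \<comment> \<open>The weight \<open>2^j\<close> turns the bound \<open>(1/4)^j\<close> on the
        squares into \<open>(1/2)^j\<close>, still summable; the added constant
        \<open>(1/2)^j\<close> is harmless on a finite measure.\<close>
      have "0 \<le> (2^j * norm (d j x) - 1)\<^sup>2 / 2^j + norm (d j x)" by simp
      also have "\<dots> = 2^j * (norm (d j x))\<^sup>2 + (1/2)^j - norm (d j x)"
        by (simp add: power2_eq_square field_simps)
      finally show "ennreal (norm (d j x)) \<le> ennreal (2^j) * ennreal ((norm (d j x))\<^sup>2) + ennreal ((1/2)^j)"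
        by (simp add: ennreal_mult[symmetric] flip: ennreal_plus)
    qed
    also have "\<dots> = ennreal (2^j) * ennreal (sqnorm \<Omega> (d j)) + ennreal ((1/2)^j) * emeasure ?M (space ?M)"
      by (subst nn_integral_add) (simp_all add: nn_integral_cmult nn_integral_norm_sq[OF d_L2])
    also have "emeasure ?M (space ?M) = ennreal \<mu>"
      using finM by (simp add: \<mu>_def emeasure_eq_ennreal_measure)
    also have "ennreal (2^j) * ennreal (sqnorm \<Omega> (d j)) + ennreal ((1/2)^j) * ennreal \<mu>
        = ennreal (2^j * sqnorm \<Omega> (d j) + (1/2)^j * \<mu>)"
      by (simp add: ennreal_mult[symmetric] sqnorm_nonneg \<mu>_def flip: ennreal_plus)
    also have "\<dots> \<le> ennreal (2^j * (1/4)^j + (1/2)^j * \<mu>)"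
      using d_sq[of j] by (intro ennreal_leI add_right_mono mult_left_mono) auto
    also have "2^j * (1/4)^j + (1/2)^j * \<mu> = (1 + \<mu>) * (1/2)^j"
      by (simp add: algebra_simps flip: power_mult_distrib)
    finally show ?thesis .
  qed
  have "(\<integral>\<^sup>+x. (\<Sum>j. ennreal (norm (d j x))) \<partial>?M) = (\<Sum>j. \<integral>\<^sup>+x. ennreal (norm (d j x)) \<partial>?M)"
    by (rule nn_integral_suminf) measurable
  also have "\<dots> \<le> (\<Sum>j. ennreal ((1 + \<mu>) * (1/2)^j))"
    by (intro suminf_le d_L1 summableI)
  also have "\<dots> = ennreal (\<Sum>j. (1 + \<mu>) * (1/2)^j)"
    by (intro suminf_ennreal2) (auto simp: \<mu>_def intro!: summable_mult)
  also have "\<dots> < \<infinity>" by simp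
  finally have "AE x in ?M. (\<Sum>j. ennreal (norm (d j x))) \<noteq> \<infinity>"
    by (intro nn_integral_PInf_AE) auto
  then have AE1: "AE x in ?M. convergent (\<lambda>n. v (k n) x)"
  proof eventually_elim
    fix x assume "(\<Sum>j. ennreal (norm (d j x))) \<noteq> \<infinity>"
    then have "summable (\<lambda>j. norm (d j x))" by (intro summable_suminf_not_top) auto
    then have "summable (\<lambda>j. d j x)" by (rule summable_norm_cancel)
    then have "convergent (\<lambda>n. \<Sum>j<n. d j x)" by (simp add: summable_iff_convergent)
    moreover have "(\<Sum>j<n. d j x) = v (k n) x - v (k 0) x" for n
      unfolding d_def by (rule sum_lessThan_telescope)
    ultimately have "convergent (\<lambda>n. v (k n) x - v (k 0) x)" by simp
    then show "convergent (\<lambda>n. v (k n) x)"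
      using convergent_add_const_right_iff[of "\<lambda>n. v (k n) x" "- v (k 0) x"] by simp
  qed
  define u where "u x = lim (\<lambda>n. v (k n) x)" for x
  have u_meas [measurable]: "u \<in> borel_measurable ?M" unfolding u_def by measurable
  have AE: "AE x in ?M. (\<lambda>n. v (k n) x) \<longlonglongrightarrow> u x"
    using AE1 unfolding u_def by (simp add: convergent_LIMSEQ_iff)
  \<comment> \<open>Here \<open>m\<close> stays fixed while Fatou's lemma is applied along
    \<open>k n >= n\<close>, so the Cauchy bound passes to the limit and places
    \<open>u - v m\<close> in \<open>L^2\<close>.\<close>
  have est: "L2_on \<Omega> (\<lambda>x. u x - v m x) \<and> sqnorm \<Omega> (\<lambda>x. u x - v m x) \<le> e"
    if e: "e > 0" and m: "\<forall>m\<ge>N'. \<forall>n\<ge>N'. sqnorm \<Omega> (\<lambda>x. v m x - v n x) \<le> e" "m \<ge> N'" for e m N'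
  proof -
    have 1: "AE x in ?M. (\<lambda>n. v (k n) x - v m x) \<longlonglongrightarrow> u x - v m x"
      using AE by eventually_elim (intro tendsto_intros)
    have 2: "\<forall>\<^sub>F n in sequentially. sqnorm \<Omega> (\<lambda>x. v (k n) x - v m x) \<le> e"
      unfolding eventually_sequentially
      using m seq_suble[OF k] order_trans by blast
    show ?thesis
      using AE_liminf_sqnorm_le[OF L2_on_diff[OF L2 L2] _ 1 2] e by simp
  qed
  obtain N1 where N1: "\<forall>m\<ge>N1. \<forall>n\<ge>N1. sqnorm \<Omega> (\<lambda>x. v m x - v n x) \<le> 1"
    using Cauchy[of 1] by auto
  have "L2_on \<Omega> (\<lambda>x. u x - v N1 x)" using est[of 1 N1 N1] N1 by simp
  from L2_on_add[OF this L2[of N1]] have uL2: "L2_on \<Omega> u" by simp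
  have lim: "(\<lambda>n. sqnorm \<Omega> (\<lambda>x. v n x - u x)) \<longlonglongrightarrow> 0"
  proof (rule LIMSEQ_I)
    fix e :: real assume "e > 0"
    obtain N' where "\<forall>m\<ge>N'. \<forall>n\<ge>N'. sqnorm \<Omega> (\<lambda>x. v m x - v n x) \<le> e/2"
      using Cauchy[of "e/2"] \<open>e > 0\<close> by auto
    then have "sqnorm \<Omega> (\<lambda>x. v n x - u x) \<le> e/2" if "n \<ge> N'" for n
      using est[of "e/2" N' n] \<open>e > 0\<close> that sqnorm_minus_commute[of \<Omega> u "v n"] by simp
    moreover have "\<bar>sqnorm \<Omega> (\<lambda>x. v n x - u x)\<bar> = sqnorm \<Omega> (\<lambda>x. v n x - u x)" for n
      by (simp add: sqnorm_nonneg)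
    ultimately show "\<exists>no. \<forall>n\<ge>no. norm (sqnorm \<Omega> (\<lambda>x. v n x - u x) - 0) < e"
      using \<open>e > 0\<close> by (intro exI[of _ N']) fastforce
  qed
  show thesis by (rule that[OF uL2 lim k AE])
qed

section \<open>Test functions and the translation estimate\<close>

lemma C_k_lincomb:
  "C_k k \<phi> \<Longrightarrow> C_k k \<psi> \<Longrightarrow> C_k k (\<lambda>x. a * \<phi> x + b * \<psi> x)"
proof (induction k arbitrary: \<phi> \<psi>)
  case 0
  then show ?case by (auto intro!: continuous_intros)
next
  case (Suc k)
  have der: "((\<lambda>x. a * \<phi> x + b * \<psi> x) has_derivative
      (\<lambda>h. a * frechet_derivative \<phi> (at x) h + b * frechet_derivative \<psi> (at x) h)) (at x)" for x
    using Suc.prems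
    by (intro has_derivative_add has_derivative_mult_right) (simp_all flip: frechet_derivative_works)
  have "partial_deriv i (\<lambda>x. a * \<phi> x + b * \<psi> x) = (\<lambda>x. a * partial_deriv i \<phi> x + b * partial_deriv i \<psi> x)" for i
    by (rule ext, subst frechet_derivative_at[OF der, symmetric]) (rule refl)
  moreover have "(\<lambda>x. a * \<phi> x + b * \<psi> x) differentiable (at x)" for x
    using der unfolding differentiable_def by blast
  ultimately show ?case using Suc by simp
qed

lemma test_function_has_derivative:
  assumes "\<phi> \<in> test_functions \<Omega>"
  shows "(\<phi> has_derivative (\<lambda>h. grad \<phi> x \<bullet> h)) (at x)"
proof -
  have "C_k (Suc 0) \<phi>" using assms by (simp add: test_functions_def del: C_k.simps)
  then have D: "(\<phi> has_derivative frechet_derivative \<phi> (at x)) (at x)"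
    by (simp flip: frechet_derivative_works)
  then have lin: "linear (frechet_derivative \<phi> (at x))"
    by (rule has_derivative_linear)
  have "frechet_derivative \<phi> (at x) h = grad \<phi> x \<bullet> h" for h
  proof -
    have "frechet_derivative \<phi> (at x) h = frechet_derivative \<phi> (at x) (\<Sum>i\<in>Basis. (h \<bullet> i) *\<^sub>R i)"
      by (simp add: euclidean_representation)
    also have "\<dots> = (\<Sum>i\<in>Basis. (h \<bullet> i) * partial_deriv i \<phi> x)"
      by (simp add: linear_sum[OF lin] linear_cmul[OF lin])
    also have "\<dots> = grad \<phi> x \<bullet> h"
      unfolding grad_def inner_sum_left by (intro sum.cong) (simp_all add: inner_commute[of h])
    finally show ?thesis .
  qed
  then have "frechet_derivative \<phi> (at x) = (\<lambda>h. grad \<phi> x \<bullet> h)" by (rule ext)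
  then show ?thesis using D by simp
qed

lemma test_function_partial_deriv:
  assumes "\<phi> \<in> test_functions \<Omega>"
  shows "partial_deriv i \<phi> x = grad \<phi> x \<bullet> i"
  by (subst frechet_derivative_at[OF test_function_has_derivative[OF assms], symmetric]) (rule refl)

lemma test_function_continuous:
  assumes "\<phi> \<in> test_functions \<Omega>" shows "continuous_on S \<phi>"
  by (intro continuous_at_imp_continuous_on ballI has_derivative_continuous)
    (rule test_function_has_derivative[OF assms])

lemma test_function_grad_continuous:
  assumes "\<phi> \<in> test_functions \<Omega>" shows "continuous_on S (grad \<phi>)"
proof -
  have "C_k (Suc 0) \<phi>" using assms by (simp add: test_functions_def del: C_k.simps)
  then have "continuous_on UNIV (partial_deriv i \<phi>)" if "i \<in> Basis" for i
    using that by simp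
  then have "continuous_on UNIV (grad \<phi>)"
    unfolding grad_def by (intro continuous_intros) auto
  then show ?thesis by (rule continuous_on_subset) simp
qed

lemma test_function_borel:
  assumes "\<phi> \<in> test_functions \<Omega>"
  shows "\<phi> \<in> borel_measurable borel" "grad \<phi> \<in> borel_measurable borel"
  using test_function_continuous[OF assms] test_function_grad_continuous[OF assms]
  by (auto intro: borel_measurable_continuous_onI)

text \<open>Off the support \<open>\<phi>\<close> vanishes on an open set, so the zero map is also a
  derivative there; by uniqueness every pairing with \<open>grad \<phi> x\<close> is zero, in
  particular its pairing with itself.\<close>

lemma test_function_outside:
  assumes "\<phi> \<in> test_functions \<Omega>" "x \<notin> closure {x. \<phi> x \<noteq> 0}"
  shows "\<phi> x = 0" "grad \<phi> x = 0"
proof -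
  have 0: "\<phi> y = 0" if "y \<notin> closure {x. \<phi> x \<noteq> 0}" for y
    using that closure_subset[of "{x. \<phi> x \<noteq> 0}"] by blast
  then show "\<phi> x = 0" using assms(2) .
  have "((\<lambda>x. 0) has_derivative (\<lambda>h. grad \<phi> x \<bullet> h)) (at x)"
    by (rule has_derivative_transform_within_open[OF test_function_has_derivative[OF assms(1)],
          where s = "- closure {x. \<phi> x \<noteq> 0}"])
      (use assms(2) in \<open>auto intro: 0 simp del: closure_complement\<close>)
  then have "(\<lambda>h. grad \<phi> x \<bullet> h) = (\<lambda>h. 0)"
    by (rule has_derivative_unique) (rule has_derivative_const)
  then have "grad \<phi> x \<bullet> grad \<phi> x = 0" by (rule fun_cong)
  then show "grad \<phi> x = 0" by simp
qed

lemma test_function_notin: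
  assumes "\<phi> \<in> test_functions \<Omega>" "x \<notin> \<Omega>" shows "\<phi> x = 0" "grad \<phi> x = 0"
  using test_function_outside[OF assms(1), of x] assms by (auto simp: test_functions_def)

lemma test_function_bounded:
  assumes "\<phi> \<in> test_functions \<Omega>"
  obtains B where "\<And>x. norm (\<phi> x) \<le> B" "\<And>x. norm (grad \<phi> x) \<le> B"
proof -
  let ?K = "closure {x. \<phi> x \<noteq> 0}"
  have K: "compact ?K" using assms by (simp add: test_functions_def)
  have "bounded (\<phi> ` ?K)" "bounded (grad \<phi> ` ?K)"
    using K by (auto intro!: compact_imp_bounded compact_continuous_image
        test_function_continuous[OF assms] test_function_grad_continuous[OF assms])
  then obtain B1 B2 where B: "\<And>x. x \<in> ?K \<Longrightarrow> norm (\<phi> x) \<le> B1" "\<And>x. x \<in> ?K \<Longrightarrow> norm (grad \<phi> x) \<le> B2"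
    unfolding bounded_iff by blast
  show thesis
  proof (rule that[of "max 0 (max B1 B2)"])
    fix x
    show "norm (\<phi> x) \<le> max 0 (max B1 B2)"
      using B(1)[of x] test_function_outside(1)[OF assms, of x] by (cases "x \<in> ?K") auto
    show "norm (grad \<phi> x) \<le> max 0 (max B1 B2)"
      using B(2)[of x] test_function_outside(2)[OF assms, of x] by (cases "x \<in> ?K") auto
  qed
qed

lemma test_functions_lincomb:
  assumes "\<phi> \<in> test_functions \<Omega>" "\<psi> \<in> test_functions \<Omega>"
  shows "(\<lambda>x. a * \<phi> x + b * \<psi> x) \<in> test_functions \<Omega>"
    and "grad (\<lambda>x. a * \<phi> x + b * \<psi> x) x = a *\<^sub>R grad \<phi> x + b *\<^sub>R grad \<psi> x"
proof -
  let ?K = "\<lambda>\<phi>. closure {x. \<phi> x \<noteq> (0::real)}"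
  have sub: "?K (\<lambda>x. a * \<phi> x + b * \<psi> x) \<subseteq> ?K \<phi> \<union> ?K \<psi>"
    by (subst closure_Un[symmetric], rule closure_mono) auto
  moreover have "compact (?K \<phi> \<union> ?K \<psi>)" using assms by (auto simp: test_functions_def)
  ultimately have "compact (?K (\<lambda>x. a * \<phi> x + b * \<psi> x))"
    by (meson bounded_subset closed_closure compact_eq_bounded_closed)
  with sub assms show *: "(\<lambda>x. a * \<phi> x + b * \<psi> x) \<in> test_functions \<Omega>"
    unfolding test_functions_def by (auto intro: C_k_lincomb)
  have "((\<lambda>x. a * \<phi> x + b * \<psi> x) has_derivative (\<lambda>h. a * (grad \<phi> x \<bullet> h) + b * (grad \<psi> x \<bullet> h))) (at x)"
    by (intro has_derivative_add has_derivative_mult_right test_function_has_derivative[OF assms(1)]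
        test_function_has_derivative[OF assms(2)])
  from has_derivative_unique[OF this test_function_has_derivative[OF *]]
  have "grad (\<lambda>x. a * \<phi> x + b * \<psi> x) x \<bullet> h = (a *\<^sub>R grad \<phi> x + b *\<^sub>R grad \<psi> x) \<bullet> h" for h
    unfolding inner_add_left inner_scaleR_left by (rule fun_cong[OF sym])
  then show "grad (\<lambda>x. a * \<phi> x + b * \<psi> x) x = a *\<^sub>R grad \<phi> x + b *\<^sub>R grad \<psi> x"
    using vector_eq_rdot by blast
qed

lemma finite_measure_lebesgue_on:
  assumes "open \<Omega>" "bounded \<Omega>" shows "finite_measure (lebesgue_on \<Omega>)"
  using emeasure_bounded_finite[OF assms(2)] assms(1)
  by (intro finite_measureI) (simp add: emeasure_restrict_space)

lemma L2_on_bounded: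
  assumes "open \<Omega>" "bounded \<Omega>" "u \<in> borel_measurable borel" "\<And>x. norm (u x) \<le> B"
  shows "L2_on \<Omega> u"
proof (rule L2_on_dominated)
  interpret finite_measure "lebesgue_on \<Omega>" by (rule finite_measure_lebesgue_on) fact+
  show "integrable (lebesgue_on \<Omega>) (\<lambda>x. B\<^sup>2)" by simp
  show "u \<in> borel_measurable (lebesgue_on \<Omega>)"
    using assms(3) by (simp add: measurable_completion measurable_restrict_space1)
  show "(norm (u x))\<^sup>2 \<le> B\<^sup>2" for x using assms(4) by (intro power_mono) auto
qed

lemma test_function_L2:
  assumes "open \<Omega>" "bounded \<Omega>" "\<phi> \<in> test_functions \<Omega>"
  shows "L2_on \<Omega> \<phi>" "L2_on \<Omega> (grad \<phi>)" "L2_on \<Omega> (partial_deriv i \<phi>)"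
proof -
  obtain B where B: "\<And>x. norm (\<phi> x) \<le> B" "\<And>x. norm (grad \<phi> x) \<le> B"
    by (rule test_function_bounded[OF assms(3)]) blast
  show "L2_on \<Omega> \<phi>" using B(1) test_function_borel[OF assms(3)] by (intro L2_on_bounded[OF assms(1,2)]) auto
  show *: "L2_on \<Omega> (grad \<phi>)" using B(2) test_function_borel[OF assms(3)] by (intro L2_on_bounded[OF assms(1,2)]) auto
  show "L2_on \<Omega> (partial_deriv i \<phi>)"
    using L2_on_inner_right[OF *, of i] by (simp add: test_function_partial_deriv[OF assms(3)])
qed

section \<open>Whole-space integrals and translations of test functions\<close>

lemma nn_integral_lebesgue_on:
  fixes F :: "'a::euclidean_space \<Rightarrow> ennreal"
  assumes "open \<Omega>"
  shows "(\<integral>\<^sup>+x. F x \<partial>lebesgue_on \<Omega>) = (\<integral>\<^sup>+x. F x * indicator \<Omega> x \<partial>lborel)"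
  using assms by (simp add: nn_integral_restrict_space nn_integral_completion)

text \<open>Translates of \<open>\<phi>\<close> leave \<open>\<Omega>\<close>, so the estimates
  below integrate over the whole space; extension by zero makes both integrals agree.\<close>

lemma nn_integral_test_function:
  assumes "open \<Omega>" "bounded \<Omega>" "\<phi> \<in> test_functions \<Omega>"
  shows "(\<integral>\<^sup>+x. ennreal ((\<phi> x)\<^sup>2) \<partial>lborel) = ennreal (sqnorm \<Omega> \<phi>)"
    and "(\<integral>\<^sup>+x. ennreal ((norm (grad \<phi> x))\<^sup>2) \<partial>lborel) = ennreal (sqnorm \<Omega> (grad \<phi>))"
proof -
  have "(\<integral>\<^sup>+x. ennreal ((\<phi> x)\<^sup>2) \<partial>lborel) = (\<integral>\<^sup>+x. ennreal ((norm (\<phi> x))\<^sup>2) * indicator \<Omega> x \<partial>lborel)"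
    using test_function_notin[OF assms(3)] by (intro nn_integral_cong) (auto split: split_indicator)
  then show "(\<integral>\<^sup>+x. ennreal ((\<phi> x)\<^sup>2) \<partial>lborel) = ennreal (sqnorm \<Omega> \<phi>)"
    using nn_integral_norm_sq[OF test_function_L2(1)[OF assms]]
    by (subst (asm) nn_integral_lebesgue_on[OF assms(1)]) simp
  have "(\<integral>\<^sup>+x. ennreal ((norm (grad \<phi> x))\<^sup>2) \<partial>lborel)
      = (\<integral>\<^sup>+x. ennreal ((norm (grad \<phi> x))\<^sup>2) * indicator \<Omega> x \<partial>lborel)"
    using test_function_notin[OF assms(3)] by (intro nn_integral_cong) (auto split: split_indicator)
  then show "(\<integral>\<^sup>+x. ennreal ((norm (grad \<phi> x))\<^sup>2) \<partial>lborel) = ennreal (sqnorm \<Omega> (grad \<phi>))"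
    using nn_integral_norm_sq[OF test_function_L2(2)[OF assms]]
    by (subst (asm) nn_integral_lebesgue_on[OF assms(1)]) simp
qed

text \<open>Cauchy-Schwarz against the constant 1, by expanding the variance-like integral of
  \<open>(m * w - I)^2\<close>, which equals \<open>m * (m * J - I^2)\<close>. For
  \<open>m = 0\<close> this says nothing, but then every integral vanishes.\<close>

lemma (in finite_measure) integral_power2_le:
  fixes w :: "'a \<Rightarrow> real"
  assumes "integrable M w" "integrable M (\<lambda>x. (w x)\<^sup>2)"
  shows "(\<integral>x. w x \<partial>M)\<^sup>2 \<le> measure M (space M) * (\<integral>x. (w x)\<^sup>2 \<partial>M)"
proof -
  define m I J where "m = measure M (space M)" and "I = (\<integral>x. w x \<partial>M)" and "J = (\<integral>x. (w x)\<^sup>2 \<partial>M)"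
  have "0 \<le> (\<integral>x. (m * w x - I)\<^sup>2 \<partial>M)" by simp
  also have "\<dots> = (\<integral>x. m\<^sup>2 * (w x)\<^sup>2 - 2 * m * I * w x + I\<^sup>2 \<partial>M)"
    by (intro Bochner_Integration.integral_cong) (auto simp: power2_eq_square algebra_simps)
  also have "\<dots> = m\<^sup>2 * J - 2 * m * I * I + I\<^sup>2 * m"
    using assms by (simp add: J_def flip: I_def m_def)
  also have "\<dots> = m * (m * J - I\<^sup>2)"
    by (simp add: power2_eq_square algebra_simps)
  finally have *: "0 \<le> m * (m * J - I\<^sup>2)" .
  have "I\<^sup>2 \<le> m * J"
  proof (cases "m = 0")
    case True
    then have "emeasure M (space M) = 0" by (simp add: emeasure_eq_measure m_def)
    then have "AE x in M. w x = 0"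
      by (intro AE_I[of _ _ "space M"]) auto
    then have "I = 0" unfolding I_def by (rule integral_eq_zero_AE)
    then show ?thesis using True by simp
  next
    case False
    then have "m > 0" by (simp add: zero_less_measure_iff m_def)
    then show ?thesis using * by (simp add: zero_le_mult_iff)
  qed
  then show ?thesis by (simp add: m_def I_def J_def)
qed

text \<open>The fundamental theorem of calculus along the segment from \<open>x\<close> to
  \<open>x + h\<close>, then Cauchy-Schwarz in the segment parameter. The right side is a
  nonnegative integral over \<open>lborel\<close>, so Tonelli applies to it without integrability
  checks.\<close>

lemma translation_pointwise:
  assumes \<phi>: "\<phi> \<in> test_functions \<Omega>"
  shows "ennreal ((\<phi> (x + h) - \<phi> x)\<^sup>2)
    \<le> (\<integral>\<^sup>+t. ennreal ((norm h)\<^sup>2) * ennreal ((norm (grad \<phi> (x + t *\<^sub>R h)))\<^sup>2) * indicator {0..1} t \<partial>lborel)"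
proof -
  define F' where "F' t = grad \<phi> (x + t *\<^sub>R h) \<bullet> h" for t
  define c where "c = \<phi> (x + h) - \<phi> x"
  have cont: "continuous_on {0..1} F'"
    unfolding F'_def
    by (intro continuous_intros continuous_on_compose2[OF test_function_grad_continuous[OF \<phi>, of UNIV]]) auto
  have der: "((\<lambda>t. \<phi> (x + t *\<^sub>R h)) has_vector_derivative F' t) (at t within {0..1})" for t
  proof -
    have "((\<lambda>t. \<phi> (x + t *\<^sub>R h)) has_derivative (\<lambda>s. grad \<phi> (x + t *\<^sub>R h) \<bullet> (s *\<^sub>R h))) (at t within {0..1})"
      by (rule has_derivative_compose[of "\<lambda>t. x + t *\<^sub>R h", OF _ test_function_has_derivative[OF \<phi>]])
         (auto intro!: derivative_eq_intros)
    then show ?thesis by (simp add: has_vector_derivative_def F'_def)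
  qed
  have I1: "(F' has_integral c) {0..1}"
    using fundamental_theorem_of_calculus[of 0 1 "\<lambda>t. \<phi> (x + t *\<^sub>R h)" F'] der by (simp add: c_def)
  define I where "I = integral {0..1} (\<lambda>t. (F' t)\<^sup>2)"
  have I2: "((\<lambda>t. (F' t)\<^sup>2) has_integral I) {0..1}"
    unfolding I_def by (intro integrable_integral integrable_continuous_interval continuous_intros cont)
  \<comment> \<open>\<open>c\<close> is the mean of \<open>F'\<close> over \<open>{0..1}\<close>, so
    expanding the square of \<open>F' - c\<close> gives \<open>I >= c^2\<close>.\<close>
  have "((\<lambda>t. (F' t)\<^sup>2 - 2 * c * F' t + c\<^sup>2) has_integral I - 2 * c * c + c\<^sup>2) {0..1}"
    using has_integral_const_real[of "c\<^sup>2" 0 1]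
    by (intro has_integral_add has_integral_diff has_integral_mult_right I1 I2) simp
  moreover have "(F' t)\<^sup>2 - 2 * c * F' t + c\<^sup>2 = (F' t - c)\<^sup>2" for t
    by (simp add: power2_eq_square algebra_simps)
  ultimately have "0 \<le> I - 2 * c * c + c\<^sup>2"
    using has_integral_nonneg by (metis (no_types, lifting) zero_le_power2)
  then have "c\<^sup>2 \<le> I" by (simp add: power2_eq_square)
  then have "ennreal (c\<^sup>2) \<le> ennreal I" by (rule ennreal_leI)
  also have "\<dots> = (\<integral>\<^sup>+t. ennreal ((F' t)\<^sup>2) * indicator {0..1} t \<partial>lborel)"
    using I2 by (subst nn_integral_has_integral_lebesgue') auto
  also have "\<dots> \<le> (\<integral>\<^sup>+t. ennreal ((norm h)\<^sup>2) * ennreal ((norm (grad \<phi> (x + t *\<^sub>R h)))\<^sup>2) * indicator {0..1} t \<partial>lborel)"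
  proof (rule nn_integral_mono, rule mult_right_mono)
    fix t
    have "(F' t)\<^sup>2 \<le> (norm h)\<^sup>2 * (norm (grad \<phi> (x + t *\<^sub>R h)))\<^sup>2"
      unfolding F'_def using Cauchy_Schwarz_ineq2[of "grad \<phi> (x + t *\<^sub>R h)" h]
      by (metis abs_ge_zero mult.commute power2_abs power_mono power_mult_distrib)
    then show "ennreal ((F' t)\<^sup>2) \<le> ennreal ((norm h)\<^sup>2) * ennreal ((norm (grad \<phi> (x + t *\<^sub>R h)))\<^sup>2)"
      by (simp add: ennreal_mult[symmetric] ennreal_leI)
  qed simp
  finally show ?thesis by (simp add: c_def)
qed

lemma nn_integral_lborel_translate:
  assumes [measurable]: "F \<in> borel_measurable borel"
  shows "(\<integral>\<^sup>+x. F (c + x) \<partial>lborel) = (\<integral>\<^sup>+x. F x \<partial>(lborel :: 'a::euclidean_space measure))"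
proof -
  have "(\<integral>\<^sup>+x. F x \<partial>(lborel :: 'a measure)) = (\<integral>\<^sup>+x. F x \<partial>distr lborel borel ((+) c))"
    by (simp add: lborel_distr_plus)
  also have "\<dots> = (\<integral>\<^sup>+x. F (c + x) \<partial>lborel)"
    by (subst nn_integral_distr) auto
  finally show ?thesis by simp
qed

text \<open>After the integrals are exchanged, translation invariance removes the shift by
  \<open>t\<close> times \<open>h\<close> from the integral over \<open>x\<close>, so each
  \<open>t\<close> in \<open>{0..1}\<close> contributes the same amount.\<close>

lemma translation_estimate:
  assumes "open \<Omega>" "bounded \<Omega>" "\<phi> \<in> test_functions \<Omega>"
  shows "(\<integral>\<^sup>+x. ennreal ((\<phi> (x + h) - \<phi> x)\<^sup>2) \<partial>lborel) \<le> ennreal ((norm h)\<^sup>2 * sqnorm \<Omega> (grad \<phi>))"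
proof -
  note [measurable] = test_function_borel[OF assms(3)]
  let ?G = "\<lambda>x. ennreal ((norm (grad \<phi> x))\<^sup>2)"
  have "(\<integral>\<^sup>+x. ennreal ((\<phi> (x + h) - \<phi> x)\<^sup>2) \<partial>lborel)
    \<le> (\<integral>\<^sup>+x. (\<integral>\<^sup>+t. ennreal ((norm h)\<^sup>2) * ?G (x + t *\<^sub>R h) * indicator {0..1::real} t \<partial>lborel) \<partial>lborel)"
    by (intro nn_integral_mono translation_pointwise[OF assms(3)])
  also have "\<dots> = (\<integral>\<^sup>+t. (\<integral>\<^sup>+x. ennreal ((norm h)\<^sup>2) * ?G (x + t *\<^sub>R h) * indicator {0..1::real} t \<partial>lborel) \<partial>lborel)"
    by (rule lborel_pair.Fubini') measurable
  also have "\<dots> = (\<integral>\<^sup>+t. ennreal ((norm h)\<^sup>2 * sqnorm \<Omega> (grad \<phi>)) * indicator {0..1::real} t \<partial>lborel)"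
  proof (rule nn_integral_cong)
    fix t :: real
    have "(\<integral>\<^sup>+x. ?G (x + t *\<^sub>R h) \<partial>lborel) = ennreal (sqnorm \<Omega> (grad \<phi>))"
      using nn_integral_lborel_translate[of ?G "t *\<^sub>R h"] nn_integral_test_function(2)[OF assms]
      by (simp add: add.commute)
    then show "(\<integral>\<^sup>+x. ennreal ((norm h)\<^sup>2) * ?G (x + t *\<^sub>R h) * indicator {0..1::real} t \<partial>lborel)
        = ennreal ((norm h)\<^sup>2 * sqnorm \<Omega> (grad \<phi>)) * indicator {0..1::real} t"
      by (simp add: nn_integral_cmult nn_integral_multc ennreal_mult sqnorm_nonneg)
  qed
  also have "\<dots> = ennreal ((norm h)\<^sup>2 * sqnorm \<Omega> (grad \<phi>))"
    by (simp add: nn_integral_cmult_indicator)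
  finally show ?thesis .
qed

text \<open>A translation by more than the diameter of \<open>\<Omega>\<close> separates \<open>\<phi>\<close> from its translate.\<close>

lemma test_function_poincare:
  fixes \<Omega> :: "'a::euclidean_space set"
  assumes "open \<Omega>" "bounded \<Omega>"
  obtains C where "C > 0" "\<And>\<phi>. \<phi> \<in> test_functions \<Omega> \<Longrightarrow> sqnorm \<Omega> \<phi> \<le> C * sqnorm \<Omega> (grad \<phi>)"
proof -
  obtain R where R: "R > 0" "\<And>x. x \<in> \<Omega> \<Longrightarrow> norm x < R"
    using bounded_pos_less[of \<Omega>] assms(2) by auto
  obtain e :: 'a where e: "norm e = 1" using vector_choose_size[of 1] by auto
  have out: "x + (2 * R) *\<^sub>R e \<notin> \<Omega>" if "x \<in> \<Omega>" for x
  proof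
    assume "x + (2 * R) *\<^sub>R e \<in> \<Omega>"
    then have "norm (x + (2 * R) *\<^sub>R e) < R" by (rule R(2))
    moreover have "norm ((2 * R) *\<^sub>R e) \<le> norm (x + (2 * R) *\<^sub>R e) + norm x"
      using norm_triangle_ineq4[of "x + (2 * R) *\<^sub>R e" x] by simp
    ultimately show False using R(2)[OF that] e R(1) by simp
  qed
  show thesis
  proof (rule that[of "(2*R)\<^sup>2"])
    fix \<phi> assume \<phi>: "\<phi> \<in> test_functions \<Omega>"
    have "ennreal (sqnorm \<Omega> \<phi>) = (\<integral>\<^sup>+x. ennreal ((\<phi> x)\<^sup>2) \<partial>lborel)"
      by (simp add: nn_integral_test_function(1)[OF assms \<phi>])
    also have "\<dots> \<le> (\<integral>\<^sup>+x. ennreal ((\<phi> (x + (2*R) *\<^sub>R e) - \<phi> x)\<^sup>2) \<partial>lborel)"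
    proof (rule nn_integral_mono)
      fix x
      show "ennreal ((\<phi> x)\<^sup>2) \<le> ennreal ((\<phi> (x + (2*R) *\<^sub>R e) - \<phi> x)\<^sup>2)"
        using out[of x] test_function_notin(1)[OF \<phi>, of x] test_function_notin(1)[OF \<phi>, of "x + (2*R) *\<^sub>R e"]
        by (cases "x \<in> \<Omega>") auto
    qed
    also have "\<dots> \<le> ennreal ((norm ((2*R) *\<^sub>R e))\<^sup>2 * sqnorm \<Omega> (grad \<phi>))"
      by (rule translation_estimate[OF assms \<phi>])
    finally show "sqnorm \<Omega> \<phi> \<le> (2*R)\<^sup>2 * sqnorm \<Omega> (grad \<phi>)"
      using e by (simp add: sqnorm_nonneg ennreal_le_iff)
  qed (use R in simp)
qed

section \<open>Compactness of bounded gradients\<close>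

text \<open>Compactness is obtained by discretisation: a function is compared with its averages over
  balls around the points of a finite net, which leaves finitely many numbers per scale to control.
  The centre \<open>c\<close> need not be the evaluation point.\<close>

definition ball_average :: "('a::euclidean_space \<Rightarrow> real) \<Rightarrow> real \<Rightarrow> 'a \<Rightarrow> real" where
  "ball_average \<phi> e c = (LINT y|restrict_space lborel (ball c e). \<phi> y) / measure lborel (ball c e)"

lemma finite_measure_ball: "finite_measure (restrict_space lborel (ball (c::'a::euclidean_space) e))"
  using emeasure_bounded_finite[OF bounded_ball[of c e]]
  by (intro finite_measureI) (simp add: emeasure_restrict_space)

lemma measure_restrict_ball:
  "measure (restrict_space lborel (ball (c::'a::euclidean_space) e)) (space (restrict_space lborel (ball c e)))
     = measure lborel (ball c e)"
  by (simp add: measure_restrict_space space_restrict_space)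

lemma test_function_integrable_ball:
  assumes "\<phi> \<in> test_functions \<Omega>"
  shows "integrable (restrict_space lborel (ball c e)) \<phi>"
    and "integrable (restrict_space lborel (ball c e)) (\<lambda>y. (a - \<phi> y)\<^sup>2)"
proof -
  note [measurable] = test_function_borel[OF assms]
  interpret finite_measure "restrict_space lborel (ball c e)" by (rule finite_measure_ball)
  obtain B where B: "\<And>x. norm (\<phi> x) \<le> B" by (rule test_function_bounded[OF assms]) blast
  show "integrable (restrict_space lborel (ball c e)) \<phi>"
    using B by (intro integrable_const_bound[of _ B]) (auto simp: measurable_restrict_space1)
  show "integrable (restrict_space lborel (ball c e)) (\<lambda>y. (a - \<phi> y)\<^sup>2)"
  proof (rule integrable_const_bound[of _ "(norm a + B)\<^sup>2"])
    have "norm (a - \<phi> y) \<le> norm a + B" for y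
      using norm_triangle_ineq4[of a "\<phi> y"] B[of y] by linarith
    then have "(norm (a - \<phi> y))\<^sup>2 \<le> (norm a + B)\<^sup>2" for y by (intro power_mono) auto
    then show "AE y in restrict_space lborel (ball c e). norm ((a - \<phi> y)\<^sup>2) \<le> (norm a + B)\<^sup>2" by simp
  qed (simp add: measurable_restrict_space1)
qed

lemma content_ball_ratio:
  assumes "e > 0"
  shows "measure lborel (ball (0::'a::euclidean_space) (2*e)) = 2 ^ DIM('a) * measure lborel (ball (0::'a) e)"
  using assms content_ball_conv_unit_ball[of "2*e" "0::'a"] content_ball_conv_unit_ball[of e "0::'a"]
  by (simp add: power_mult_distrib)

text \<open>Jensen's inequality on \<open>ball c e\<close>, then enlargement of the domain to
  \<open>ball x (2*e)\<close>. The bound depends on \<open>x\<close> and \<open>e\<close> only, so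
  \<open>c\<close> may be chosen as any function of \<open>x\<close>.\<close>

lemma ball_average_pointwise:
  fixes x c :: "'a::euclidean_space"
  assumes "\<phi> \<in> test_functions \<Omega>" "e > 0" "dist c x < e"
  shows "ennreal ((\<phi> x - ball_average \<phi> e c)\<^sup>2)
    \<le> ennreal (1 / measure lborel (ball (0::'a) e)) *
       (\<integral>\<^sup>+h. ennreal ((\<phi> (x + h) - \<phi> x)\<^sup>2) * indicator (ball 0 (2*e)) h \<partial>lborel)"
proof -
  note [measurable] = test_function_borel[OF assms(1)]
  have [measurable]: "ball x (2*e) \<in> sets borel" by simp
  let ?M = "restrict_space lborel (ball c e)"
  interpret finite_measure ?M by (rule finite_measure_ball)
  define \<beta> where "\<beta> = measure lborel (ball c e)"
  have \<beta>: "\<beta> > 0" using assms(2) by (simp add: \<beta>_def content_ball_pos)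
  have \<beta>0: "measure lborel (ball (0::'a) e) = \<beta>"
    using content_ball_conv_unit_ball[of e c] content_ball_conv_unit_ball[of e "0::'a"] assms(2)
    by (simp add: \<beta>_def)
  note int = test_function_integrable_ball[OF assms(1), of c e]
  let ?J = "\<integral>y. (\<phi> x - \<phi> y)\<^sup>2 \<partial>?M"
  have meas: "measure ?M (space ?M) = \<beta>" unfolding \<beta>_def by (rule measure_restrict_ball)
  have "(\<integral>y. \<phi> x - \<phi> y \<partial>?M) = \<beta> * \<phi> x - (\<integral>y. \<phi> y \<partial>?M)"
    using int(1) meas by simp
  also have "\<dots> = \<beta> * (\<phi> x - ball_average \<phi> e c)"
    using \<beta> by (simp add: ball_average_def field_simps flip: \<beta>_def)
  finally have "(\<beta> * (\<phi> x - ball_average \<phi> e c))\<^sup>2 \<le> \<beta> * ?J"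
    using integral_power2_le[of "\<lambda>y. \<phi> x - \<phi> y"] int meas by simp
  then have "\<beta> * (\<beta> * (\<phi> x - ball_average \<phi> e c)\<^sup>2) \<le> \<beta> * ?J"
    by (simp add: power2_eq_square algebra_simps)
  then have "\<beta> * (\<phi> x - ball_average \<phi> e c)\<^sup>2 \<le> ?J" using \<beta> by simp
  then have "(\<phi> x - ball_average \<phi> e c)\<^sup>2 \<le> (1 / \<beta>) * ?J" using \<beta> by (simp add: field_simps)
  then have "ennreal ((\<phi> x - ball_average \<phi> e c)\<^sup>2) \<le> ennreal (1 / \<beta>) * ennreal ?J"
    using \<beta> by (subst ennreal_mult[symmetric]) (auto intro: ennreal_leI)
  also have "ennreal ?J = (\<integral>\<^sup>+y. ennreal ((\<phi> x - \<phi> y)\<^sup>2) \<partial>?M)"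
    by (intro nn_integral_eq_integral[symmetric] int) auto
  also have "\<dots> = (\<integral>\<^sup>+y. ennreal ((\<phi> x - \<phi> y)\<^sup>2) * indicator (ball c e) y \<partial>lborel)"
    by (simp add: nn_integral_restrict_space)
  also have "\<dots> \<le> (\<integral>\<^sup>+y. ennreal ((\<phi> x - \<phi> y)\<^sup>2) * indicator (ball x (2*e)) y \<partial>lborel)"
  proof (intro nn_integral_mono mult_left_mono)
    fix y
    have "y \<in> ball x (2*e)" if "y \<in> ball c e"
      using that assms(3) dist_triangle[of x y c] by (simp add: dist_commute)
    then show "(indicator (ball c e) y :: ennreal) \<le> indicator (ball x (2*e)) y"
      by (auto split: split_indicator)
  qed simp
  also have "\<dots> = (\<integral>\<^sup>+h. ennreal ((\<phi> x - \<phi> (x + h))\<^sup>2) * indicator (ball x (2*e)) (x + h) \<partial>lborel)"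
    by (rule nn_integral_lborel_translate[symmetric]) measurable
  also have "\<dots> = (\<integral>\<^sup>+h. ennreal ((\<phi> (x + h) - \<phi> x)\<^sup>2) * indicator (ball 0 (2*e)) h \<partial>lborel)"
    by (intro nn_integral_cong) (auto simp: power2_commute dist_norm split: split_indicator)
  finally show ?thesis unfolding \<beta>0 by (simp add: mult_left_mono)
qed

text \<open>Integrate the pointwise bound and use the translation estimate for each \<open>h\<close>
  of norm below \<open>2*e\<close>: the constant is \<open>(2*e)^2\<close> times the volume ratio
  \<open>2 ^ DIM('a)\<close> of the two balls. Since \<open>g\<close> is simple, the averaged
  function is measurable without any regularity of the average in its centre.\<close>

lemma ball_average_estimate:
  fixes \<Omega> :: "'a::euclidean_space set"
  assumes "open \<Omega>" "bounded \<Omega>" "\<phi> \<in> test_functions \<Omega>" "e > 0"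
    and g: "simple_function borel g" "\<And>x. x \<in> \<Omega> \<Longrightarrow> dist (g x) x < e"
  shows "L2_on \<Omega> (\<lambda>x. \<phi> x - ball_average \<phi> e (g x))"
    and "sqnorm \<Omega> (\<lambda>x. \<phi> x - ball_average \<phi> e (g x)) \<le> 4 * 2 ^ DIM('a) * e\<^sup>2 * sqnorm \<Omega> (grad \<phi>)"
proof -
  note [measurable] = test_function_borel[OF assms(3)]
  have [measurable]: "ball (0::'a) (2*e) \<in> sets borel" by simp
  let ?S = "sqnorm \<Omega> (grad \<phi>)"
  have S: "?S \<ge> 0" by (rule sqnorm_nonneg)
  define \<beta> where "\<beta> = measure lborel (ball (0::'a) e)"
  have \<beta>: "\<beta> > 0" using assms(4) by (simp add: \<beta>_def content_ball_pos)
  have "simple_function borel (ball_average \<phi> e \<circ> g)" by (rule simple_function_compose[OF g(1)])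
  then have [measurable]: "(\<lambda>x. ball_average \<phi> e (g x)) \<in> borel_measurable borel"
    by (auto simp: o_def dest: borel_measurable_simple_function)
  have meas: "(\<lambda>x. \<phi> x - ball_average \<phi> e (g x)) \<in> borel_measurable (lebesgue_on \<Omega>)"
    by (intro measurable_restrict_space1 measurable_completion) simp
  let ?F = "\<lambda>x h. ennreal ((\<phi> (x + h) - \<phi> x)\<^sup>2) * indicator (ball 0 (2*e)) h"
  have "(\<integral>\<^sup>+x. ennreal ((norm (\<phi> x - ball_average \<phi> e (g x)))\<^sup>2) \<partial>lebesgue_on \<Omega>)
      = (\<integral>\<^sup>+x. ennreal ((\<phi> x - ball_average \<phi> e (g x))\<^sup>2) * indicator \<Omega> x \<partial>lborel)"
    by (simp add: nn_integral_lebesgue_on[OF assms(1)])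
  also have "\<dots> \<le> (\<integral>\<^sup>+x. ennreal (1 / \<beta>) * (\<integral>\<^sup>+h. ?F x h \<partial>lborel) \<partial>lborel)"
  proof (rule nn_integral_mono)
    fix x
    show "ennreal ((\<phi> x - ball_average \<phi> e (g x))\<^sup>2) * indicator \<Omega> x
        \<le> ennreal (1 / \<beta>) * (\<integral>\<^sup>+h. ?F x h \<partial>lborel)"
      using ball_average_pointwise[OF assms(3,4) g(2), of x] by (cases "x \<in> \<Omega>") (auto simp: \<beta>_def)
  qed
  also have "\<dots> = ennreal (1 / \<beta>) * (\<integral>\<^sup>+x. (\<integral>\<^sup>+h. ?F x h \<partial>lborel) \<partial>lborel)"
    by (rule nn_integral_cmult) measurable
  also have "(\<integral>\<^sup>+x. (\<integral>\<^sup>+h. ?F x h \<partial>lborel) \<partial>lborel) = (\<integral>\<^sup>+h. (\<integral>\<^sup>+x. ?F x h \<partial>lborel) \<partial>lborel)"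
    by (rule lborel_pair.Fubini') measurable
  also have "\<dots> \<le> (\<integral>\<^sup>+h. ennreal ((2*e)\<^sup>2 * ?S) * indicator (ball (0::'a) (2*e)) h \<partial>lborel)"
  proof (rule nn_integral_mono)
    fix h :: 'a
    have "(\<integral>\<^sup>+x. ?F x h \<partial>lborel) = (\<integral>\<^sup>+x. ennreal ((\<phi> (x + h) - \<phi> x)\<^sup>2) \<partial>lborel) * indicator (ball 0 (2*e)) h"
      by (rule nn_integral_multc) measurable
    also have "\<dots> \<le> ennreal ((norm h)\<^sup>2 * ?S) * indicator (ball 0 (2*e)) h"
      by (intro mult_right_mono translation_estimate[OF assms(1-3)]) simp
    also have "\<dots> \<le> ennreal ((2*e)\<^sup>2 * ?S) * indicator (ball 0 (2*e)) h"
    proof (cases "h \<in> ball 0 (2*e)")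
      case True
      then have "(norm h)\<^sup>2 \<le> (2*e)\<^sup>2" by (intro power_mono) auto
      then show ?thesis using S by (intro mult_right_mono ennreal_leI) auto
    qed simp
    finally show "(\<integral>\<^sup>+x. ?F x h \<partial>lborel) \<le> ennreal ((2*e)\<^sup>2 * ?S) * indicator (ball 0 (2*e)) h" .
  qed
  also have "\<dots> = ennreal ((2*e)\<^sup>2 * ?S) * ennreal (measure lborel (ball (0::'a) (2*e)))"
    using emeasure_bounded_finite[OF bounded_ball[of "0::'a" "2*e"]]
    by (subst nn_integral_cmult_indicator) (simp_all add: emeasure_eq_ennreal_measure)
  finally have "(\<integral>\<^sup>+x. ennreal ((norm (\<phi> x - ball_average \<phi> e (g x)))\<^sup>2) \<partial>lebesgue_on \<Omega>)
      \<le> ennreal (1 / \<beta>) * (ennreal ((2*e)\<^sup>2 * ?S) * ennreal (measure lborel (ball (0::'a) (2*e))))"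
    by (simp add: mult_left_mono)
  also have "\<dots> = ennreal (1 / \<beta> * ((2*e)\<^sup>2 * ?S * measure lborel (ball (0::'a) (2*e))))"
    using \<beta> S by (subst ennreal_mult[symmetric], simp, simp, subst ennreal_mult[symmetric]) (simp_all del: power_mult_distrib)
  also have "1 / \<beta> * ((2*e)\<^sup>2 * ?S * measure lborel (ball (0::'a) (2*e))) = 4 * 2 ^ DIM('a) * e\<^sup>2 * ?S"
    using \<beta> unfolding content_ball_ratio[OF assms(4)] \<beta>_def[symmetric] by (simp add: power_mult_distrib)
  finally have le: "(\<integral>\<^sup>+x. ennreal ((norm (\<phi> x - ball_average \<phi> e (g x)))\<^sup>2) \<partial>lebesgue_on \<Omega>)
      \<le> ennreal (4 * 2 ^ DIM('a) * e\<^sup>2 * ?S)" .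
  show "L2_on \<Omega> (\<lambda>x. \<phi> x - ball_average \<phi> e (g x))"
    and "sqnorm \<Omega> (\<lambda>x. \<phi> x - ball_average \<phi> e (g x)) \<le> 4 * 2 ^ DIM('a) * e\<^sup>2 * ?S"
    using L2_on_nn_integralI[OF meas le] S by auto
qed

text \<open>Assigns to each point a nearby centre of a finite net, from total boundedness of the
  closure. The induction over the centres settles overlaps: the ball inserted last wins.\<close>

lemma simple_function_near:
  fixes \<Omega> :: "'a::euclidean_space set"
  assumes "bounded \<Omega>" "e > 0"
  obtains g where "simple_function borel g" "\<And>x. x \<in> \<Omega> \<Longrightarrow> dist (g x) x < e"
proof -
  have "compact (closure \<Omega>)" using assms(1) by simp
  then obtain C where C: "finite C" "closure \<Omega> \<subseteq> (\<Union>c\<in>C. ball c e)"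
    using assms(2) by (metis compact_eq_totally_bounded)
  have "\<exists>g. simple_function borel g \<and> (\<forall>x \<in> (\<Union>c\<in>C. ball c e). dist (g x) x < e)"
    using C(1)
  proof induction
    case empty
    then show ?case by (intro exI[of _ "\<lambda>_. 0"]) simp
  next
    case (insert c C)
    then obtain g where g: "simple_function borel g" "\<forall>x \<in> (\<Union>c\<in>C. ball c e). dist (g x) x < e" by auto
    have "simple_function borel (\<lambda>x. if x \<in> ball c e then c else g x)"
      by (rule simple_function_If_set) (use g(1) in auto)
    then show ?case using g(2) by (intro exI[of _ "\<lambda>x. if x \<in> ball c e then c else g x"]) auto
  qed
  then obtain g where "simple_function borel g" "\<forall>x \<in> (\<Union>c\<in>C. ball c e). dist (g x) x < e" by auto
  then show thesis using C(2) closure_subset[of \<Omega>] by (intro that[of g]) blast+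
qed

text \<open>The integral is deliberately not divided by the volume of the ball: the bound is then
  uniform in the centre and in \<open>e <= 1\<close>, as a diagonal argument over all scales at once
  asks for. It follows from Cauchy-Schwarz and \<open>|I| <= 1 + I^2\<close>.\<close>

lemma ball_average_bound:
  fixes c :: "'a::euclidean_space"
  assumes "open \<Omega>" "bounded \<Omega>" "\<phi> \<in> test_functions \<Omega>" "e > 0" "e \<le> 1"
  shows "\<bar>LINT y|restrict_space lborel (ball c e). \<phi> y\<bar> \<le> 1 + measure lborel (ball (0::'a) 1) * sqnorm \<Omega> \<phi>"
proof -
  note [measurable] = test_function_borel[OF assms(3)]
  let ?M = "restrict_space lborel (ball c e)"
  interpret finite_measure ?M by (rule finite_measure_ball)
  note int = test_function_integrable_ball[OF assms(3), of c e]
  let ?I = "LINT y|?M. \<phi> y"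
  have int2: "integrable ?M (\<lambda>y. (\<phi> y)\<^sup>2)" using int(2)[of 0] by simp
  have "ennreal (\<integral>y. (\<phi> y)\<^sup>2 \<partial>?M) = (\<integral>\<^sup>+y. ennreal ((\<phi> y)\<^sup>2) \<partial>?M)"
    by (intro nn_integral_eq_integral[symmetric] int2) auto
  also have "\<dots> = (\<integral>\<^sup>+y. ennreal ((\<phi> y)\<^sup>2) * indicator (ball c e) y \<partial>lborel)"
    by (simp add: nn_integral_restrict_space)
  also have "\<dots> \<le> (\<integral>\<^sup>+y. ennreal ((\<phi> y)\<^sup>2) \<partial>lborel)"
    by (intro nn_integral_mono) (auto split: split_indicator)
  also have "\<dots> = ennreal (sqnorm \<Omega> \<phi>)" by (rule nn_integral_test_function[OF assms(1-3)])
  finally have J: "(\<integral>y. (\<phi> y)\<^sup>2 \<partial>?M) \<le> sqnorm \<Omega> \<phi>"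
    by (simp add: ennreal_le_iff sqnorm_nonneg)
  have "e ^ DIM('a) \<le> 1" using assms(4,5) by (simp add: power_le_one)
  then have \<beta>: "measure lborel (ball c e) \<le> measure lborel (ball (0::'a) 1)"
    using content_ball_conv_unit_ball[of e c] assms(4) by (simp add: mult_left_le_one_le)
  have "?I\<^sup>2 \<le> measure lborel (ball c e) * (\<integral>y. (\<phi> y)\<^sup>2 \<partial>?M)"
    using integral_power2_le[OF int(1) int2] unfolding measure_restrict_ball .
  also have "\<dots> \<le> measure lborel (ball (0::'a) 1) * sqnorm \<Omega> \<phi>"
    using J \<beta> by (intro mult_mono) auto
  finally have "?I\<^sup>2 \<le> measure lborel (ball (0::'a) 1) * sqnorm \<Omega> \<phi>" .
  moreover have "\<bar>?I\<bar> \<le> 1 + ?I\<^sup>2"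
  proof -
    have "0 \<le> (\<bar>?I\<bar> - 1)\<^sup>2" by simp
    then have "2 * \<bar>?I\<bar> \<le> 1 + ?I\<^sup>2" by (simp add: power2_diff)
    then show ?thesis by simp
  qed
  ultimately show ?thesis by linarith
qed

text \<open>The gradient bound makes the discretisation error at scale \<open>r j\<close> of order
  \<open>(r j)^2\<close>, uniformly in \<open>n\<close>. What remains at a fixed scale are finitely
  many averages, which converge along a diagonal subsequence, so the discretised functions are
  uniformly Cauchy.\<close>

lemma rellich_test_functions:
  fixes \<Omega> :: "'a::euclidean_space set" and \<phi> :: "nat \<Rightarrow> 'a \<Rightarrow> real"
  assumes \<Omega>: "open \<Omega>" "bounded \<Omega>" and \<phi>: "\<And>n. \<phi> n \<in> test_functions \<Omega>"
    and M: "\<And>n. sqnorm \<Omega> (grad (\<phi> n)) \<le> M"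
  obtains k where "strict_mono (k::nat\<Rightarrow>nat)"
    "\<And>e. e > 0 \<Longrightarrow> \<exists>N. \<forall>m\<ge>N. \<forall>n\<ge>N. sqnorm \<Omega> (\<lambda>x. \<phi> (k m) x - \<phi> (k n) x) \<le> e"
proof -
  have M0: "M \<ge> 0" using order_trans[OF sqnorm_nonneg M] .
  obtain C where C: "C > 0" "\<And>\<phi>. \<phi> \<in> test_functions \<Omega> \<Longrightarrow> sqnorm \<Omega> \<phi> \<le> C * sqnorm \<Omega> (grad \<phi>)"
    by (rule test_function_poincare[OF \<Omega>]) blast
  have L: "sqnorm \<Omega> (\<phi> n) \<le> C * M" for n
    using C(2)[OF \<phi>[of n]] M[of n] C(1) by (meson mult_left_mono less_imp_le order_trans)
  define r where "r j = 1 / real (Suc j)" for j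
  have r: "r j > 0" "r j \<le> 1" for j by (auto simp: r_def)
  have "\<exists>g. simple_function borel g \<and> (\<forall>x\<in>\<Omega>. dist (g x) x < r j)" for j
    using simple_function_near[OF \<Omega>(2) r(1)[of j]] by metis
  then obtain g where g: "\<And>j. simple_function borel (g j)" "\<And>j x. x \<in> \<Omega> \<Longrightarrow> dist (g j x) x < r j"
    by metis
  have fin: "finite (range (g j))" for j using simple_functionD(1)[OF g(1)[of j]] by simp
  \<comment> \<open>All scales are indexed together, so that a single subsequence serves every
    accuracy \<open>e\<close> later on.\<close>
  define S where "S = (SIGMA j:UNIV. range (g j))"
  have "countable S" unfolding S_def by (intro countable_SIGMA) (auto simp: countable_finite[OF fin])
  define F where "F n = (\<lambda>(j, c). LINT y|restrict_space lborel (ball c (r j)). \<phi> n y)" for n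
  have "norm (F n z) \<le> 1 + measure lborel (ball (0::'a) 1) * (C * M)" for n z
  proof -
    obtain j c where z: "z = (j, c)" by fastforce
    have "norm (F n z) \<le> 1 + measure lborel (ball (0::'a) 1) * sqnorm \<Omega> (\<phi> n)"
      using ball_average_bound[OF \<Omega> \<phi> r] by (simp add: F_def z)
    also have "\<dots> \<le> 1 + measure lborel (ball (0::'a) 1) * (C * M)"
      using L by (intro add_left_mono mult_left_mono) auto
    finally show ?thesis .
  qed
  then obtain k where k: "strict_mono (k::nat\<Rightarrow>nat)" "\<And>z. z \<in> S \<Longrightarrow> \<exists>l. (\<lambda>n. F (k n) z) \<longlonglongrightarrow> l"
    using function_convergent_subsequence[OF \<open>countable S\<close>, of F] by blast
  have conv: "\<exists>l. (\<lambda>n. ball_average (\<phi> (k n)) (r j) c) \<longlonglongrightarrow> l" if c: "c \<in> range (g j)" for j c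
  proof -
    obtain l where "(\<lambda>n. F (k n) (j, c)) \<longlonglongrightarrow> l" using k(2)[of "(j,c)"] c by (auto simp: S_def)
    then have "(\<lambda>n. F (k n) (j, c) / measure lborel (ball c (r j))) \<longlonglongrightarrow> l / measure lborel (ball c (r j))"
      using r(1)[of j] by (intro tendsto_divide tendsto_const) (simp_all add: content_ball_pos less_imp_neq[symmetric])
    then show ?thesis by (auto simp: F_def ball_average_def)
  qed
  interpret fm: finite_measure "lebesgue_on \<Omega>" by (rule finite_measure_lebesgue_on[OF \<Omega>])
  define \<mu> where "\<mu> = measure (lebesgue_on \<Omega>) (space (lebesgue_on \<Omega>))"
  have \<mu>: "\<mu> \<ge> 0" by (simp add: \<mu>_def)
  show thesis
  proof (rule that[OF k(1)])
    fix e :: real assume e: "e > 0"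
    define K where "K = 4 * 2 ^ DIM('a) * (M + 1)"
    have K: "K > 0" using M0 by (simp add: K_def add_nonneg_pos)
    have "(\<lambda>j. K * (r j)\<^sup>2) \<longlonglongrightarrow> K * 0\<^sup>2"
      unfolding r_def using LIMSEQ_inverse_real_of_nat
      by (intro tendsto_intros) (simp add: inverse_eq_divide)
    then have "\<forall>\<^sub>F j in sequentially. K * (r j)\<^sup>2 < e / 10"
      using e by (intro order_tendstoD(2)[where y = "K * 0\<^sup>2"]) auto
    then obtain j where j: "K * (r j)\<^sup>2 < e / 10" by (auto simp: eventually_sequentially)
    let ?P = "\<lambda>n x. ball_average (\<phi> (k n)) (r j) (g j x)"
    have A: "L2_on \<Omega> (\<lambda>x. \<phi> (k n) x - ?P n x)" "sqnorm \<Omega> (\<lambda>x. \<phi> (k n) x - ?P n x) \<le> e / 10" for n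
    proof -
      note est = ball_average_estimate[OF \<Omega> \<phi> r(1) g, of "k n" j]
      show "L2_on \<Omega> (\<lambda>x. \<phi> (k n) x - ?P n x)" using est(1) by simp
      have "4 * 2 ^ DIM('a) * (r j)\<^sup>2 * sqnorm \<Omega> (grad (\<phi> (k n))) \<le> 4 * 2 ^ DIM('a) * (r j)\<^sup>2 * (M + 1)"
        using M[of "k n"] by (intro mult_left_mono) auto
      also have "\<dots> = K * (r j)\<^sup>2" by (simp add: K_def)
      finally show "sqnorm \<Omega> (\<lambda>x. \<phi> (k n) x - ?P n x) \<le> e / 10" using est(2) j by simp
    qed
    \<comment> \<open>Two averages within \<open>\<delta>\<close> of a common limit differ by at
      most \<open>2 * \<delta>\<close>; the value makes \<open>4 * \<delta>^2\<close> times the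
      measure of \<open>\<Omega>\<close> at most \<open>e / 10\<close>.\<close>
    define \<delta> where "\<delta> = sqrt (e / (10 * (\<mu> + 1))) / 2"
    have \<delta>: "\<delta> > 0" using e \<mu> by (simp add: \<delta>_def)
    have \<delta>2': "4 * \<delta>\<^sup>2 = e / (10 * (\<mu> + 1))"
      using e \<mu> by (simp add: \<delta>_def power_divide) (simp add: field_simps)
    have \<delta>2: "4 * \<delta>\<^sup>2 * \<mu> \<le> e / 10"
      unfolding \<delta>2' using e \<mu> by (simp add: field_simps)
    obtain l where l: "\<And>c. c \<in> range (g j) \<Longrightarrow> (\<lambda>n. ball_average (\<phi> (k n)) (r j) c) \<longlonglongrightarrow> l c"
      using conv[of _ j] by metis
    have "\<forall>\<^sub>F n in sequentially. \<forall>c\<in>range (g j). dist (ball_average (\<phi> (k n)) (r j) c) (l c) < \<delta>"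
      using fin l \<delta> by (intro eventually_ball_finite) (auto dest: tendstoD)
    then obtain N where N: "\<And>n c. n \<ge> N \<Longrightarrow> c \<in> range (g j) \<Longrightarrow> dist (ball_average (\<phi> (k n)) (r j) c) (l c) < \<delta>"
      unfolding eventually_sequentially by blast
    have B: "L2_on \<Omega> (\<lambda>x. ?P m x - ?P n x) \<and> sqnorm \<Omega> (\<lambda>x. ?P m x - ?P n x) \<le> e / 10" if "m \<ge> N" "n \<ge> N" for m n
    proof -
      have "L2_on \<Omega> (\<lambda>x. \<phi> (k n) x - (\<phi> (k n) x - ?P n x))" for n
        by (intro L2_on_diff A test_function_L2[OF \<Omega> \<phi>])
      then have L2: "L2_on \<Omega> (\<lambda>x. ?P m x - ?P n x)" by (intro L2_on_diff) simp_all
      have "(norm (?P m x - ?P n x))\<^sup>2 \<le> 4 * \<delta>\<^sup>2" for x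
      proof -
        have "dist (?P m x) (?P n x) \<le> 2 * \<delta>"
          using N[OF that(1), of "g j x"] N[OF that(2), of "g j x"]
            dist_triangle2[of "?P m x" "?P n x" "l (g j x)"] by simp
        then have "(norm (?P m x - ?P n x))\<^sup>2 \<le> (2 * \<delta>)\<^sup>2"
          unfolding dist_norm by (intro power_mono) auto
        then show ?thesis by (simp add: power_mult_distrib)
      qed
      then have "sqnorm \<Omega> (\<lambda>x. ?P m x - ?P n x) \<le> (LINT x|lebesgue_on \<Omega>. 4 * \<delta>\<^sup>2)"
        unfolding sqnorm_def using L2_on_integrable[OF L2] by (intro integral_mono) auto
      also have "\<dots> \<le> e / 10" using \<delta>2 by (simp add: \<mu>_def mult.commute)
      finally show ?thesis using L2 by simp
    qed
    \<comment> \<open>Discretisation error, difference of averages, discretisation error: using the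
      factor 2 estimate twice gives \<open>2 * (e/10) + 2 * (4 * (e/10)) = e\<close>.\<close>
    have "sqnorm \<Omega> (\<lambda>x. \<phi> (k m) x - \<phi> (k n) x) \<le> e" if mn: "m \<ge> N" "n \<ge> N" for m n
    proof -
      have "sqnorm \<Omega> (\<lambda>x. (?P m x - ?P n x) + (?P n x - \<phi> (k n) x)) \<le> 2 * (e/10) + 2 * (e/10)"
        using sqnorm_add_le[of \<Omega> "\<lambda>x. ?P m x - ?P n x" "\<lambda>x. ?P n x - \<phi> (k n) x"] B[OF mn] A[of n]
          L2_on_scaleR[OF A(1)[of n], of "-1"] sqnorm_minus_commute[of \<Omega> "?P n" "\<phi> (k n)"] by simp
      moreover have "L2_on \<Omega> (\<lambda>x. (?P m x - ?P n x) + (?P n x - \<phi> (k n) x))"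
        using L2_on_diff[OF conjunct1[OF B[OF mn]] A(1)[of n]] by (simp add: algebra_simps)
      ultimately show ?thesis
        using sqnorm_add_le[OF A(1)[of m], of "\<lambda>x. (?P m x - ?P n x) + (?P n x - \<phi> (k n) x)"] A(2)[of m] e
        by simp
    qed
    then show "\<exists>N. \<forall>m\<ge>N. \<forall>n\<ge>N. sqnorm \<Omega> (\<lambda>x. \<phi> (k m) x - \<phi> (k n) x) \<le> e" by blast
  qed
qed

section \<open>The space of Sobolev functions vanishing on the boundary\<close>

text \<open>Trades the approximating sequence and the root of a sum for an epsilon statement with
  two separate bounds, which composes directly with the factor 2 estimates. The sequence is
  recovered from the accuracies \<open>1 / (n + 1)\<close>.\<close>

lemma H10_iff:
  "(u, Du) \<in> H10 \<Omega> \<longleftrightarrow> (u, Du) \<in> H1 \<Omega> \<and>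
    (\<forall>e>0. \<exists>\<phi>\<in>test_functions \<Omega>. sqnorm \<Omega> (\<lambda>x. \<phi> x - u x) \<le> e \<and> sqnorm \<Omega> (\<lambda>x. grad \<phi> x - Du x) \<le> e)"
proof -
  let ?d = "\<lambda>\<phi>. sqnorm \<Omega> (\<lambda>x. \<phi> x - u x) + sqnorm \<Omega> (\<lambda>x. grad \<phi> x - Du x)"
  have "(u, Du) \<in> H10 \<Omega> \<longleftrightarrow> (u, Du) \<in> H1 \<Omega> \<and>
    (\<exists>\<phi>. (\<forall>n. \<phi> n \<in> test_functions \<Omega>) \<and> (\<lambda>n. sqrt (?d (\<phi> n))) \<longlonglongrightarrow> 0)"
    by (simp add: H10_def sqnorm_def)
  also have "(\<exists>\<phi>. (\<forall>n. \<phi> n \<in> test_functions \<Omega>) \<and> (\<lambda>n. sqrt (?d (\<phi> n))) \<longlonglongrightarrow> 0) \<longleftrightarrow>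
    (\<forall>e>0. \<exists>\<phi>\<in>test_functions \<Omega>. sqnorm \<Omega> (\<lambda>x. \<phi> x - u x) \<le> e \<and> sqnorm \<Omega> (\<lambda>x. grad \<phi> x - Du x) \<le> e)"
    (is "?L \<longleftrightarrow> ?R")
  proof
    assume ?L
    then obtain \<phi> where \<phi>: "\<And>n. \<phi> n \<in> test_functions \<Omega>" "(\<lambda>n. sqrt (?d (\<phi> n))) \<longlonglongrightarrow> 0" by blast
    show ?R
    proof (intro allI impI)
      fix e :: real assume "e > 0"
      then have "\<forall>\<^sub>F n in sequentially. sqrt (?d (\<phi> n)) < sqrt e"
        using \<phi>(2) by (intro order_tendstoD(2)[where y = 0]) auto
      then obtain n where "sqrt (?d (\<phi> n)) < sqrt e" by (auto simp: eventually_sequentially)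
      then have "?d (\<phi> n) \<le> e" by simp
      then show "\<exists>\<phi>\<in>test_functions \<Omega>. sqnorm \<Omega> (\<lambda>x. \<phi> x - u x) \<le> e \<and> sqnorm \<Omega> (\<lambda>x. grad \<phi> x - Du x) \<le> e"
        using \<phi>(1)[of n] sqnorm_nonneg[of \<Omega> "\<lambda>x. \<phi> n x - u x"] sqnorm_nonneg[of \<Omega> "\<lambda>x. grad (\<phi> n) x - Du x"]
        by (intro bexI[of _ "\<phi> n"]) auto
    qed
  next
    assume R: ?R
    have "\<exists>\<phi>\<in>test_functions \<Omega>. sqnorm \<Omega> (\<lambda>x. \<phi> x - u x) \<le> 1 / real (Suc n)
        \<and> sqnorm \<Omega> (\<lambda>x. grad \<phi> x - Du x) \<le> 1 / real (Suc n)" for n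
      using R by simp
    then obtain \<phi> where \<phi>: "\<And>n. \<phi> n \<in> test_functions \<Omega>"
      "\<And>n. sqnorm \<Omega> (\<lambda>x. \<phi> n x - u x) \<le> 1 / real (Suc n)"
      "\<And>n. sqnorm \<Omega> (\<lambda>x. grad (\<phi> n) x - Du x) \<le> 1 / real (Suc n)"
      by metis
    have "(\<lambda>n. ?d (\<phi> n)) \<longlonglongrightarrow> 0"
    proof (rule tendsto_sandwich)
      show "\<forall>\<^sub>F n in sequentially. 0 \<le> ?d (\<phi> n)" by (simp add: sqnorm_nonneg)
      show "\<forall>\<^sub>F n in sequentially. ?d (\<phi> n) \<le> 2 * inverse (real (Suc n))"
      proof (intro always_eventually allI)
        show "?d (\<phi> n) \<le> 2 * inverse (real (Suc n))" for n
          using add_mono[OF \<phi>(2)[of n] \<phi>(3)[of n]] by (simp add: inverse_eq_divide)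
      qed
      show "(\<lambda>n. 2 * inverse (real (Suc n))) \<longlonglongrightarrow> 0"
        using tendsto_mult_right_zero[OF LIMSEQ_inverse_real_of_nat] by simp
    qed simp
    from tendsto_real_sqrt[OF this] have "(\<lambda>n. sqrt (?d (\<phi> n))) \<longlonglongrightarrow> 0" by simp
    with \<phi>(1) show ?L by blast
  qed
  finally show ?thesis .
qed

lemma H10_D:
  assumes "(u, Du) \<in> H10 \<Omega>" shows "L2_on \<Omega> u" "L2_on \<Omega> Du" "weak_gradient_on \<Omega> u Du"
  using assms by (auto simp: H10_def H1_def)

lemma zero_in_test_functions: "(\<lambda>x. 0) \<in> test_functions \<Omega>"
proof -
  have "C_k k (\<lambda>x::'a. 0)" for k by (induction k) auto
  then show ?thesis by (simp add: test_functions_def)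
qed

lemma H10_zero: "((\<lambda>x. 0), (\<lambda>x. 0)) \<in> H10 \<Omega>"
  unfolding H10_iff
proof (intro conjI allI impI)
  show "((\<lambda>x. 0), (\<lambda>x. 0)) \<in> H1 \<Omega>" by (simp add: H1_def L2_on_zero weak_gradient_on_def)
  show "\<exists>\<phi>\<in>test_functions \<Omega>. sqnorm \<Omega> (\<lambda>x. \<phi> x - 0) \<le> e \<and> sqnorm \<Omega> (\<lambda>x. grad \<phi> x - 0) \<le> e"
    if "e > 0" for e
    using that zero_in_test_functions
    by (intro bexI[of _ "\<lambda>x. 0"]) (auto simp: grad_def)
qed

text \<open>Puts both sides into the form of \<open>L^2\<close> pairings, with \<open>\<phi>\<close>
  times the basis vector \<open>i\<close> as a vector field, so that the general facts on integrals
  of inner products apply.\<close>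

lemma weak_gradient_on_iff:
  "weak_gradient_on \<Omega> u Du \<longleftrightarrow> (\<forall>\<phi>\<in>test_functions \<Omega>. \<forall>i\<in>Basis.
        (LINT x|lebesgue_on \<Omega>. u x \<bullet> partial_deriv i \<phi> x) = - (LINT x|lebesgue_on \<Omega>. Du x \<bullet> (\<phi> x *\<^sub>R i)))"
  by (simp add: weak_gradient_on_def mult.commute)

lemma test_function_scaleR_L2:
  assumes "open \<Omega>" "bounded \<Omega>" "\<phi> \<in> test_functions \<Omega>"
  shows "L2_on \<Omega> (\<lambda>x. \<phi> x *\<^sub>R i)"
proof -
  note [measurable] = test_function_borel[OF assms(3)]
  obtain B where B: "\<And>x. norm (\<phi> x) \<le> B" by (rule test_function_bounded[OF assms(3)]) blast
  show ?thesis
    using B by (intro L2_on_bounded[OF assms(1,2), of _ "B * norm i"]) (auto intro!: mult_right_mono)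
qed

text \<open>The linear structure needed for the parallelogram argument on gradients. Midpoints of
  approximating test functions approximate with the same accuracy \<open>e\<close>, by convexity of
  the squared norm.\<close>

lemma H10_midpoint:
  assumes \<Omega>: "open \<Omega>" "bounded \<Omega>" and u: "(u, Du) \<in> H10 \<Omega>" and v: "(v, Dv) \<in> H10 \<Omega>"
  shows "((\<lambda>x. (1/2) *\<^sub>R (u x + v x)), (\<lambda>x. (1/2) *\<^sub>R (Du x + Dv x))) \<in> H10 \<Omega>"
  unfolding H10_iff
proof (intro conjI allI impI)
  note uD = H10_D[OF u] and vD = H10_D[OF v]
  have "weak_gradient_on \<Omega> (\<lambda>x. (1/2) *\<^sub>R (u x + v x)) (\<lambda>x. (1/2) *\<^sub>R (Du x + Dv x))"
    unfolding weak_gradient_on_iff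
  proof (intro ballI)
    fix \<phi> i assume \<phi>: "\<phi> \<in> test_functions \<Omega>" and i: "i \<in> (Basis :: 'a set)"
    have "(LINT x|lebesgue_on \<Omega>. ((1/2) *\<^sub>R (u x + v x)) \<bullet> partial_deriv i \<phi> x)
       = (LINT x|lebesgue_on \<Omega>. (1/2) * (u x \<bullet> partial_deriv i \<phi> x + v x \<bullet> partial_deriv i \<phi> x))"
      by (intro Bochner_Integration.integral_cong) (simp_all add: inner_add_left field_simps)
    also have "\<dots> = (1/2) * ((LINT x|lebesgue_on \<Omega>. u x \<bullet> partial_deriv i \<phi> x) + (LINT x|lebesgue_on \<Omega>. v x \<bullet> partial_deriv i \<phi> x))"
      by (simp only: integral_mult_right_zero
        Bochner_Integration.integral_add[OF L2_on_inner_integrable[OF uD(1) test_function_L2(3)[OF \<Omega> \<phi>]]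
           L2_on_inner_integrable[OF vD(1) test_function_L2(3)[OF \<Omega> \<phi>]]])
    also have "\<dots> = (1/2) * (- (LINT x|lebesgue_on \<Omega>. Du x \<bullet> (\<phi> x *\<^sub>R i)) + - (LINT x|lebesgue_on \<Omega>. Dv x \<bullet> (\<phi> x *\<^sub>R i)))"
      using uD(3) vD(3) \<phi> i unfolding weak_gradient_on_iff by simp
    also have "\<dots> = - (LINT x|lebesgue_on \<Omega>. (1/2) * (Du x \<bullet> (\<phi> x *\<^sub>R i) + Dv x \<bullet> (\<phi> x *\<^sub>R i)))"
      by (simp only: integral_mult_right_zero minus_add_distrib[symmetric] mult_minus_right
        Bochner_Integration.integral_add[OF L2_on_inner_integrable[OF uD(2) test_function_scaleR_L2[OF \<Omega> \<phi>]]
           L2_on_inner_integrable[OF vD(2) test_function_scaleR_L2[OF \<Omega> \<phi>]]])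
    also have "(LINT x|lebesgue_on \<Omega>. (1/2) * (Du x \<bullet> (\<phi> x *\<^sub>R i) + Dv x \<bullet> (\<phi> x *\<^sub>R i)))
       = (LINT x|lebesgue_on \<Omega>. ((1/2) *\<^sub>R (Du x + Dv x)) \<bullet> (\<phi> x *\<^sub>R i))"
      by (intro Bochner_Integration.integral_cong) (simp_all add: inner_add_left field_simps)
    finally show "(LINT x|lebesgue_on \<Omega>. ((1/2) *\<^sub>R (u x + v x)) \<bullet> partial_deriv i \<phi> x)
        = - (LINT x|lebesgue_on \<Omega>. ((1/2) *\<^sub>R (Du x + Dv x)) \<bullet> (\<phi> x *\<^sub>R i))" .
  qed
  then show "((\<lambda>x. (1/2) *\<^sub>R (u x + v x)), (\<lambda>x. (1/2) *\<^sub>R (Du x + Dv x))) \<in> H1 \<Omega>"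
    unfolding H1_def using uD(1,2) vD(1,2) by (auto intro!: L2_on_scaleR L2_on_add simp del: real_scaleR_def)
next
  note uD = H10_D[OF u] and vD = H10_D[OF v]
  fix e :: real assume e: "e > 0"
  obtain \<phi> where \<phi>: "\<phi> \<in> test_functions \<Omega>" "sqnorm \<Omega> (\<lambda>x. \<phi> x - u x) \<le> e" "sqnorm \<Omega> (\<lambda>x. grad \<phi> x - Du x) \<le> e"
    using u e unfolding H10_iff by blast
  obtain \<psi> where \<psi>: "\<psi> \<in> test_functions \<Omega>" "sqnorm \<Omega> (\<lambda>x. \<psi> x - v x) \<le> e" "sqnorm \<Omega> (\<lambda>x. grad \<psi> x - Dv x) \<le> e"
    using v e unfolding H10_iff by blast
  let ?\<zeta> = "\<lambda>x. (1/2) * \<phi> x + (1/2) * \<psi> x"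
  note \<zeta> = test_functions_lincomb[OF \<phi>(1) \<psi>(1), of "1/2" "1/2"]
  note L = test_function_L2(1,2)[OF \<Omega> \<phi>(1)] test_function_L2(1,2)[OF \<Omega> \<psi>(1)]
  have half: "sqnorm \<Omega> (\<lambda>x. (1/2) *\<^sub>R (a x + b x)) \<le> e"
    if "L2_on \<Omega> a" "L2_on \<Omega> b" "sqnorm \<Omega> a \<le> e" "sqnorm \<Omega> b \<le> e" for a b :: "'a \<Rightarrow> 'c::euclidean_space"
    using sqnorm_midpoint_le[OF that(1,2) L2_on_zero] that(3,4) by simp
  have eq1: "?\<zeta> x - (1/2) *\<^sub>R (u x + v x) = (1/2) *\<^sub>R ((\<phi> x - u x) + (\<psi> x - v x))" for x
    by (simp add: field_simps)
  have 1: "sqnorm \<Omega> (\<lambda>x. ?\<zeta> x - (1/2) *\<^sub>R (u x + v x)) \<le> e"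
    using half[OF L2_on_diff[OF L(1) uD(1)] L2_on_diff[OF L(3) vD(1)] \<phi>(2) \<psi>(2)] unfolding eq1 .
  have eq2: "grad ?\<zeta> x - (1/2) *\<^sub>R (Du x + Dv x) = (1/2) *\<^sub>R ((grad \<phi> x - Du x) + (grad \<psi> x - Dv x))" for x
    unfolding \<zeta>(2) by (simp add: scaleR_diff_right scaleR_add_right)
  have 2: "sqnorm \<Omega> (\<lambda>x. grad ?\<zeta> x - (1/2) *\<^sub>R (Du x + Dv x)) \<le> e"
    using half[OF L2_on_diff[OF L(2) uD(2)] L2_on_diff[OF L(4) vD(2)] \<phi>(3) \<psi>(3)] unfolding eq2 .
  show "\<exists>\<zeta>\<in>test_functions \<Omega>. sqnorm \<Omega> (\<lambda>x. \<zeta> x - (1/2) *\<^sub>R (u x + v x)) \<le> e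
      \<and> sqnorm \<Omega> (\<lambda>x. grad \<zeta> x - (1/2) *\<^sub>R (Du x + Dv x)) \<le> e"
    by (rule bexI[OF _ \<zeta>(1)]) (rule conjI[OF 1 2])
qed

text \<open>Both sides of the weak gradient identity are pairings with a fixed square-integrable
  function, hence continuous in \<open>L^2\<close>. Density survives by approximating a close member
  of the sequence: two errors \<open>e/4\<close>, each doubled, add up to \<open>e\<close>.\<close>

lemma H10_closed:
  assumes \<Omega>: "open \<Omega>" "bounded \<Omega>" and v: "\<And>n. (v n, Dv n) \<in> H10 \<Omega>" and L2: "L2_on \<Omega> u" "L2_on \<Omega> G"
    and lim: "(\<lambda>n. sqnorm \<Omega> (\<lambda>x. v n x - u x)) \<longlonglongrightarrow> 0" "(\<lambda>n. sqnorm \<Omega> (\<lambda>x. Dv n x - G x)) \<longlonglongrightarrow> 0"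
  shows "(u, G) \<in> H10 \<Omega>"
  unfolding H10_iff
proof (intro conjI allI impI)
  note vD = H10_D[OF v]
  have "weak_gradient_on \<Omega> u G"
    unfolding weak_gradient_on_iff
  proof (intro ballI)
    fix \<phi> i assume \<phi>: "\<phi> \<in> test_functions \<Omega>" and i: "i \<in> (Basis :: 'a set)"
    have "(\<lambda>n. LINT x|lebesgue_on \<Omega>. v n x \<bullet> partial_deriv i \<phi> x) \<longlonglongrightarrow> (LINT x|lebesgue_on \<Omega>. u x \<bullet> partial_deriv i \<phi> x)"
      by (rule L2_on_integral_inner_tendsto[OF vD(1) L2(1) test_function_L2(3)[OF \<Omega> \<phi>] lim(1)])
    moreover have "(\<lambda>n. - (LINT x|lebesgue_on \<Omega>. Dv n x \<bullet> (\<phi> x *\<^sub>R i))) \<longlonglongrightarrow> - (LINT x|lebesgue_on \<Omega>. G x \<bullet> (\<phi> x *\<^sub>R i))"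
      by (rule tendsto_minus[OF L2_on_integral_inner_tendsto[OF vD(2) L2(2) test_function_scaleR_L2[OF \<Omega> \<phi>] lim(2)]])
    moreover have "(LINT x|lebesgue_on \<Omega>. v n x \<bullet> partial_deriv i \<phi> x) = - (LINT x|lebesgue_on \<Omega>. Dv n x \<bullet> (\<phi> x *\<^sub>R i))" for n
      using vD(3)[of n] \<phi> i unfolding weak_gradient_on_iff by blast
    ultimately show "(LINT x|lebesgue_on \<Omega>. u x \<bullet> partial_deriv i \<phi> x) = - (LINT x|lebesgue_on \<Omega>. G x \<bullet> (\<phi> x *\<^sub>R i))"
      by (simp only: LIMSEQ_unique)
  qed
  then show "(u, G) \<in> H1 \<Omega>" using L2 by (simp add: H1_def)
next
  note vD = H10_D[OF v]
  fix e :: real assume e: "e > 0"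
  have "\<forall>\<^sub>F n in sequentially. sqnorm \<Omega> (\<lambda>x. v n x - u x) < e/4 \<and> sqnorm \<Omega> (\<lambda>x. Dv n x - G x) < e/4"
    using order_tendstoD(2)[OF lim(1), of "e/4"] order_tendstoD(2)[OF lim(2), of "e/4"] e
    by (simp add: eventually_conj_iff)
  then obtain n where n: "sqnorm \<Omega> (\<lambda>x. v n x - u x) < e/4" "sqnorm \<Omega> (\<lambda>x. Dv n x - G x) < e/4"
    by (auto simp: eventually_sequentially)
  obtain \<phi> where \<phi>: "\<phi> \<in> test_functions \<Omega>" "sqnorm \<Omega> (\<lambda>x. \<phi> x - v n x) \<le> e/4" "sqnorm \<Omega> (\<lambda>x. grad \<phi> x - Dv n x) \<le> e/4"
    using v[of n] e unfolding H10_iff by (meson zero_less_divide_iff zero_less_numeral)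
  note L = test_function_L2(1,2)[OF \<Omega> \<phi>(1)]
  show "\<exists>\<phi>\<in>test_functions \<Omega>. sqnorm \<Omega> (\<lambda>x. \<phi> x - u x) \<le> e \<and> sqnorm \<Omega> (\<lambda>x. grad \<phi> x - G x) \<le> e"
    using sqnorm_diff_le[OF L(1) vD(1)[of n] L2(1)] sqnorm_diff_le[OF L(2) vD(2)[of n] L2(2)] n \<phi>
    by (intro bexI[OF _ \<phi>(1)]) auto
qed

section \<open>Poincare, Rellich and lower semicontinuity on the closure of the test
  functions\<close>

lemma H10_poincare:
  fixes \<Omega> :: "'a::euclidean_space set"
  assumes \<Omega>: "open \<Omega>" "bounded \<Omega>"
  obtains C where "C > 0" "\<And>u Du. (u, Du) \<in> H10 \<Omega> \<Longrightarrow> sqnorm \<Omega> u \<le> C * sqnorm \<Omega> Du"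
proof -
  obtain C where C: "C > 0" "\<And>\<phi>. \<phi> \<in> test_functions \<Omega> \<Longrightarrow> sqnorm \<Omega> \<phi> \<le> C * sqnorm \<Omega> (grad \<phi>)"
    by (rule test_function_poincare[OF \<Omega>]) blast
  show thesis
  \<comment> \<open>The factor 4 is the product of the factors 2 lost in passing from
    \<open>u\<close> to a test function and from its gradient back to \<open>Du\<close>.\<close>
  proof (rule that[of "4 * C"])
    fix u Du assume u: "(u, Du) \<in> H10 \<Omega>"
    note uD = H10_D[OF u]
    show "sqnorm \<Omega> u \<le> 4 * C * sqnorm \<Omega> Du"
    proof (rule field_le_epsilon)
      fix \<epsilon> :: real assume \<epsilon>: "\<epsilon> > 0"
      \<comment> \<open>Solves \<open>2 * e + 4 * C * e = \<epsilon>\<close>, the total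
        approximation error collected below.\<close>
      define e where "e = \<epsilon> / (2 + 4 * C)"
      have e: "e > 0" "2 * e + 4 * C * e = \<epsilon>"
        using \<epsilon> C(1) by (simp_all add: e_def divide_simps) (simp add: algebra_simps)
      obtain \<phi> where \<phi>: "\<phi> \<in> test_functions \<Omega>" "sqnorm \<Omega> (\<lambda>x. \<phi> x - u x) \<le> e" "sqnorm \<Omega> (\<lambda>x. grad \<phi> x - Du x) \<le> e"
        using u e(1) unfolding H10_iff by blast
      note L = test_function_L2(1,2)[OF \<Omega> \<phi>(1)]
      have "sqnorm \<Omega> u \<le> 2 * e + 2 * sqnorm \<Omega> \<phi>"
        using sqnorm_diff_le[OF uD(1) L(1) L2_on_zero] \<phi>(2) sqnorm_minus_commute[of \<Omega> u \<phi>] by simp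
      also have "\<dots> \<le> 2 * e + 2 * (C * sqnorm \<Omega> (grad \<phi>))" using C(2)[OF \<phi>(1)] by simp
      also have "\<dots> \<le> 2 * e + 2 * (C * (2 * e + 2 * sqnorm \<Omega> Du))"
        using sqnorm_diff_le[OF L(2) uD(2) L2_on_zero] \<phi>(3) C(1) by (intro add_left_mono mult_left_mono) auto
      also have "\<dots> = 4 * C * sqnorm \<Omega> Du + (2 * e + 4 * C * e)" by (simp add: algebra_simps)
      finally show "sqnorm \<Omega> u \<le> 4 * C * sqnorm \<Omega> Du + \<epsilon>" by (simp add: e(2))
    qed
  qed (use C(1) in simp)
qed

text \<open>Each \<open>v n\<close> is replaced by a test function at squared distance at most
  \<open>1 / (n + 1)\<close> in value and gradient. These have a Cauchy subsequence, and the
  vanishing distance hands the property back to \<open>v\<close>; completeness supplies the limit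
  and the a.e. convergence.\<close>

lemma H10_rellich:
  fixes \<Omega> :: "'a::euclidean_space set"
  assumes \<Omega>: "open \<Omega>" "bounded \<Omega>" and v: "\<And>n. (v n, Dv n) \<in> H10 \<Omega>"
    and M: "\<And>n. sqnorm \<Omega> (Dv n) \<le> M"
  obtains k u where "strict_mono (k::nat\<Rightarrow>nat)" "L2_on \<Omega> u"
    "(\<lambda>n. sqnorm \<Omega> (\<lambda>x. v (k n) x - u x)) \<longlonglongrightarrow> 0"
    "AE x in lebesgue_on \<Omega>. (\<lambda>n. v (k n) x) \<longlonglongrightarrow> u x"
proof -
  note vD = H10_D[OF v]
  define r where "r n = 1 / real (Suc n)" for n
  have r: "r n > 0" "r n \<le> 1" for n by (auto simp: r_def)
  have "\<exists>\<phi>\<in>test_functions \<Omega>. sqnorm \<Omega> (\<lambda>x. \<phi> x - v n x) \<le> r n \<and> sqnorm \<Omega> (\<lambda>x. grad \<phi> x - Dv n x) \<le> r n" for n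
    using v[of n] r(1)[of n] unfolding H10_iff by blast
  then obtain \<phi> where \<phi>: "\<And>n. \<phi> n \<in> test_functions \<Omega>" "\<And>n. sqnorm \<Omega> (\<lambda>x. \<phi> n x - v n x) \<le> r n"
    "\<And>n. sqnorm \<Omega> (\<lambda>x. grad (\<phi> n) x - Dv n x) \<le> r n" by metis
  note L = test_function_L2(1,2)[OF \<Omega> \<phi>(1)]
  have grad_bound: "sqnorm \<Omega> (grad (\<phi> n)) \<le> 2 + 2 * M" for n
    using sqnorm_diff_le[OF L(2) vD(2) L2_on_zero, of n n] \<phi>(3)[of n] r(2)[of n] M[of n] by simp
  obtain k where k: "strict_mono (k::nat\<Rightarrow>nat)"
    "\<And>e. e > 0 \<Longrightarrow> \<exists>N. \<forall>m\<ge>N. \<forall>n\<ge>N. sqnorm \<Omega> (\<lambda>x. \<phi> (k m) x - \<phi> (k n) x) \<le> e"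
    by (rule rellich_test_functions[of \<Omega> \<phi>, OF \<Omega> \<phi>(1) grad_bound]) blast
  have Cauchy: "\<exists>N. \<forall>m\<ge>N. \<forall>n\<ge>N. sqnorm \<Omega> (\<lambda>x. v (k m) x - v (k n) x) \<le> e" if e: "e > 0" for e
  proof -
    obtain N1 where N1: "\<forall>m\<ge>N1. \<forall>n\<ge>N1. sqnorm \<Omega> (\<lambda>x. \<phi> (k m) x - \<phi> (k n) x) \<le> e/10"
      using k(2)[of "e/10"] e by auto
    obtain N2 where N2: "r N2 < e/10"
      unfolding r_def using reals_Archimedean[of "e/10"] e by (auto simp: inverse_eq_divide)
    have rk: "r (k n) \<le> e/10" if "n \<ge> N2" for n
    proof -
      have "N2 \<le> k n" using that seq_suble[OF k(1), of n] by simp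
      then have "r (k n) \<le> r N2" unfolding r_def by (intro divide_left_mono) auto
      then show ?thesis using N2 by simp
    qed
    have "sqnorm \<Omega> (\<lambda>x. v (k m) x - v (k n) x) \<le> e" if mn: "m \<ge> max N1 N2" "n \<ge> max N1 N2" for m n
    proof -
      have "sqnorm \<Omega> (\<lambda>x. \<phi> (k m) x - v (k n) x) \<le> 2 * (e/10) + 2 * (e/10)"
        using sqnorm_diff_le[OF L(1)[of "k m"] L(1)[of "k n"] vD(1)[of "k n"]] N1 mn \<phi>(2)[of "k n"] rk[of n] by fastforce
      then show ?thesis
        using sqnorm_diff_le[OF vD(1)[of "k m"] L(1)[of "k m"] vD(1)[of "k n"]] \<phi>(2)[of "k m"] rk[of m] mn e
          sqnorm_minus_commute[of \<Omega> "v (k m)" "\<phi> (k m)"] by simp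
    qed
    then show ?thesis by blast
  qed
  have fin: "emeasure lebesgue \<Omega> < \<infinity>" "\<Omega> \<in> sets lebesgue"
    using emeasure_bounded_finite[OF \<Omega>(2)] \<Omega>(1) by auto
  obtain u k' where u: "L2_on \<Omega> u" "(\<lambda>n. sqnorm \<Omega> (\<lambda>x. v (k n) x - u x)) \<longlonglongrightarrow> 0"
    "strict_mono (k'::nat\<Rightarrow>nat)" "AE x in lebesgue_on \<Omega>. (\<lambda>n. v (k (k' n)) x) \<longlonglongrightarrow> u x"
    by (rule L2_complete[of \<Omega> "\<lambda>n. v (k n)", OF fin vD(1) Cauchy]) blast
  show thesis
    using LIMSEQ_subseq_LIMSEQ[OF u(2,3)] u strict_mono_o[OF k(1) u(3)]
    by (intro that[of "k \<circ> k'" u]) (simp_all add: o_def)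
qed

text \<open>Weak lower semicontinuity of the Dirichlet integral without weak topologies: the elements of
  \<open>H\<^sup>1\<^sub>0\<close> that are \<open>L\<^sup>2\<close>-close to \<open>u\<close> form a convex set, and by the parallelogram law almost minimal
  gradients in these shrinking sets form a Cauchy sequence.\<close>

lemma H10_gradient_lsc:
  fixes \<Omega> :: "'a::euclidean_space set"
  assumes \<Omega>: "open \<Omega>" "bounded \<Omega>" and v: "\<And>n. (v n, Dv n) \<in> H10 \<Omega>" and u: "L2_on \<Omega> u"
    and lim: "(\<lambda>n. sqnorm \<Omega> (\<lambda>x. v n x - u x)) \<longlonglongrightarrow> 0" and D: "(\<lambda>n. sqnorm \<Omega> (Dv n)) \<longlonglongrightarrow> D"
  obtains G where "(u, G) \<in> H10 \<Omega>" "sqnorm \<Omega> G \<le> D"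
proof -
  define r where "r n = 1 / real (Suc n)" for n
  have r: "r n > 0" for n by (auto simp: r_def)
  have r_anti: "r j \<le> r i" if "i \<le> j" for i j unfolding r_def using that by (intro divide_left_mono) auto
  have r0: "r \<longlonglongrightarrow> 0" unfolding r_def using LIMSEQ_inverse_real_of_nat by (simp add: inverse_eq_divide)
  \<comment> \<open>The sets \<open>K j\<close> shrink with \<open>j\<close>, so their infima
    \<open>c j\<close> increase; each contains a tail of the given sequence, so \<open>c j\<close>
    is at most \<open>D\<close>.\<close>
  define K where "K j = {(w, W) \<in> H10 \<Omega>. sqnorm \<Omega> (\<lambda>x. w x - u x) \<le> r j}" for j
  define c where "c j = (INF (w, W)\<in>K j. sqnorm \<Omega> W)" for j
  have bdd: "bdd_below ((\<lambda>(w, W). sqnorm \<Omega> W) ` K j)" for j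
    by (intro bdd_belowI[of _ 0]) (auto simp: sqnorm_nonneg)
  have c_le: "c j \<le> sqnorm \<Omega> W" if "(w, W) \<in> K j" for j w W
    unfolding c_def using cINF_lower[OF bdd that] by simp
  have vK: "\<forall>\<^sub>F n in sequentially. (v n, Dv n) \<in> K j" for j
    using order_tendstoD(2)[OF lim r[of j]] by eventually_elim (simp add: K_def v)
  have K_ne: "K j \<noteq> {}" for j
    using eventually_happens'[OF sequentially_bot vK[of j]] by auto
  have c_mono: "c i \<le> c j" if "i \<le> j" for i j
    unfolding c_def using K_ne bdd r_anti[OF that] by (intro cINF_superset_mono) (auto simp: K_def)
  have c_D: "c j \<le> D" for j
    by (rule tendsto_lowerbound[OF D]) (use vK[of j] in \<open>auto elim!: eventually_mono intro: c_le\<close>)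
  have D0: "D \<ge> 0" by (rule LIMSEQ_le_const[OF D]) (simp add: sqnorm_nonneg)
  have "\<exists>w W. (w, W) \<in> K j \<and> sqnorm \<Omega> W < c j + r j" for j
    using cINF_less_iff[OF K_ne bdd, of j "c j + r j"] r[of j] unfolding c_def by force
  then obtain w W where wW: "\<And>j. (w j, W j) \<in> K j" "\<And>j. sqnorm \<Omega> (W j) < c j + r j" by metis
  have H: "(w j, W j) \<in> H10 \<Omega>" and wr: "sqnorm \<Omega> (\<lambda>x. w j x - u x) \<le> r j" for j using wW(1)[of j] by (auto simp: K_def)
  note HD = H10_D[OF H]
  \<comment> \<open>The midpoint of \<open>w i\<close> and \<open>w j\<close> still lies in the
    larger set \<open>K j\<close>, so its gradient has energy at least \<open>c j\<close>; the
    parallelogram law then leaves only \<open>2 * (c i - c j)\<close> and the defects of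
    near-minimality.\<close>
  have diff: "sqnorm \<Omega> (\<lambda>x. W i x - W j x) \<le> 2 * (c i - c j) + 4 * r j" if ij: "j \<le> i" for i j
  proof -
    have "sqnorm \<Omega> (\<lambda>x. (1/2) *\<^sub>R (w i x + w j x) - u x) \<le> r j"
      using sqnorm_midpoint_le[OF HD(1)[of i] HD(1)[of j] u] wr[of i] wr[of j] r_anti[OF ij] by simp
    then have "((\<lambda>x. (1/2) *\<^sub>R (w i x + w j x)), (\<lambda>x. (1/2) *\<^sub>R (W i x + W j x))) \<in> K j"
      unfolding K_def using H10_midpoint[OF \<Omega> H H, of i j] by (simp del: real_scaleR_def)
    from c_le[OF this] have "sqnorm \<Omega> (\<lambda>x. W i x - W j x) \<le> 2 * sqnorm \<Omega> (W i) + 2 * sqnorm \<Omega> (W j) - 4 * c j"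
      unfolding sqnorm_parallelogram[OF HD(2)[of i] HD(2)[of j]] by simp
    then show ?thesis using wW(2)[of i] wW(2)[of j] r_anti[OF ij] by argo
  qed
  have "\<exists>L. c \<longlonglongrightarrow> L \<and> (\<forall>i. c i \<le> L)"
    using c_mono c_D by (metis incseq_convergent incseq_def)
  then obtain L where L: "c \<longlonglongrightarrow> L" "\<And>i. c i \<le> L" by blast
  have Cauchy: "\<exists>N. \<forall>m\<ge>N. \<forall>n\<ge>N. sqnorm \<Omega> (\<lambda>x. W m x - W n x) \<le> e" if e: "e > 0" for e
  proof -
    have "(\<lambda>n. 2 * (L - c n) + 4 * r n) \<longlonglongrightarrow> 2 * (L - L) + 4 * 0" by (intro tendsto_intros L r0)
    then have "\<forall>\<^sub>F n in sequentially. 2 * (L - c n) + 4 * r n < e"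
      using e by (intro order_tendstoD(2)) auto
    then obtain N where N: "\<And>n. n \<ge> N \<Longrightarrow> 2 * (L - c n) + 4 * r n < e" by (auto simp: eventually_sequentially)
    have *: "sqnorm \<Omega> (\<lambda>x. W i x - W j x) \<le> e" if "j \<ge> N" "j \<le> i" for i j
      using diff[OF that(2)] L(2)[of i] N[OF that(1)] by simp
    have "sqnorm \<Omega> (\<lambda>x. W m x - W n x) \<le> e" if "m \<ge> N" "n \<ge> N" for m n
      using *[of n m] *[of m n] that sqnorm_minus_commute[of \<Omega> "W m" "W n"] by (cases "n \<le> m") auto
    then show ?thesis by blast
  qed
  have fin: "emeasure lebesgue \<Omega> < \<infinity>" "\<Omega> \<in> sets lebesgue"
    using emeasure_bounded_finite[OF \<Omega>(2)] \<Omega>(1) by auto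
  obtain G k where G: "L2_on \<Omega> G" "(\<lambda>n. sqnorm \<Omega> (\<lambda>x. W n x - G x)) \<longlonglongrightarrow> 0"
    "strict_mono (k::nat\<Rightarrow>nat)" "AE x in lebesgue_on \<Omega>. (\<lambda>n. W (k n) x) \<longlonglongrightarrow> G x"
    by (rule L2_complete[OF fin HD(2) Cauchy]) blast
  have "(\<lambda>n. sqnorm \<Omega> (\<lambda>x. w n x - u x)) \<longlonglongrightarrow> 0"
    by (rule tendsto_sandwich[OF _ _ tendsto_const r0]) (auto simp: sqnorm_nonneg wr)
  then have "(u, G) \<in> H10 \<Omega>" using H10_closed[OF \<Omega> H u G(1) _ G(2)] by blast
  \<comment> \<open>Near-minimality bounds the energy of \<open>W n\<close> by
    \<open>D + r n\<close>; Fatou's lemma along the a.e. convergent subsequence transfers this up to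
    an arbitrary \<open>e\<close>.\<close>
  moreover have "sqnorm \<Omega> G \<le> D"
  proof (rule field_le_epsilon)
    fix e :: real assume e: "e > 0"
    have "\<forall>\<^sub>F n in sequentially. r (k n) < e"
      using order_tendstoD(2)[OF LIMSEQ_subseq_LIMSEQ[OF r0 G(3)] e] by (simp add: o_def)
    then have "\<forall>\<^sub>F n in sequentially. sqnorm \<Omega> (W (k n)) \<le> D + e"
    proof eventually_elim
      fix n assume "r (k n) < e"
      then show "sqnorm \<Omega> (W (k n)) \<le> D + e" using wW(2)[of "k n"] c_D[of "k n"] by linarith
    qed
    then show "sqnorm \<Omega> G \<le> D + e"
      using AE_liminf_sqnorm_le(2)[OF HD(2) L2_on_measurable[OF G(1)] G(4)] D0 e by simp
  qed
  ultimately show thesis by (rule that)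
qed

section \<open>Elimination of the potential\<close>

text \<open>The right side is minimal at \<open>t = 1\<close>. The tangent bounds
  \<open>1 + x <= exp x\<close> at \<open>x = - s * ln t\<close> and \<open>ln t <= t - 1\<close>
  combine so that the logarithms cancel.\<close>

lemma add_powr_neg_ge:
  fixes t s :: real
  assumes "t > 0" "s > 0" shows "1 + 1 / s \<le> t + t powr (-s) / s"
proof -
  have "1 + (- s * ln t) \<le> t powr (-s)"
    using exp_ge_add_one_self[of "- s * ln t"] assms by (simp add: powr_def)
  then have "(1 - s * ln t) / s \<le> t powr (-s) / s"
    using assms by (intro divide_right_mono) auto
  moreover have "(1 - s * ln t) / s = 1 / s - ln t" using assms by (simp add: field_simps)
  moreover have "ln t \<le> t - 1" by (rule ln_le_minus_one[OF assms(1)])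
  ultimately show ?thesis by linarith
qed

text \<open>With \<open>q = 2 * s / (s+1)\<close>: multiplying \<open>r^2\<close> by the optimal
  weight \<open>r^(-q/s)\<close> gives \<open>r^q\<close>.\<close>

lemma exponent_identity:
  fixes s :: real assumes "s > 0" shows "2 + - (2 * s / (s+1)) / s = 2 * s / (s+1)"
proof -
  have "(2 * s / (s+1)) / s = 2 / (s+1)" using assms by simp
  moreover have "2 - 2 / (s+1) = 2 * s / (s+1)" using assms by (simp add: field_simps)
  ultimately show ?thesis by simp
qed

text \<open>Pointwise Lagrange duality for minimising \<open>r^2 * w\<close> under a constraint on
  \<open>w^(-s)\<close>: \<open>A\<close> will be the integral of \<open>|u|^q\<close>, and
  \<open>A^(1 + 1/s) / s\<close> is the multiplier.\<close>

lemma potential_young_real: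
  fixes r A s w :: real
  assumes "r > 0" "A > 0" "s > 0" "w > 0"
  shows "(1 + 1/s) * (r powr (2 * s / (s+1)) * A powr (1/s)) \<le> r\<^sup>2 * w + A powr (1 + 1/s) / s * w powr (-s)"
proof -
  define q where "q = 2 * s / (s+1)"
  \<comment> \<open>The stationary point of the right side in \<open>w\<close>; writing
    \<open>w = t * U\<close> takes out the common factor \<open>r^q * A^(1/s)\<close> and leaves the
    one-variable inequality in \<open>t\<close>.\<close>
  define U where "U = r powr (-q/s) * A powr (1/s)"
  define t where "t = w / U"
  have U: "U > 0" using assms by (simp add: U_def)
  have t: "t > 0" "w = t * U" using U assms(4) by (simp_all add: t_def)
  have q: "2 + - q / s = q" unfolding q_def by (rule exponent_identity[OF assms(3)])
  have 1: "r\<^sup>2 * U = r powr q * A powr (1/s)"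
    using assms(1) powr_add[of r 2 "-q/s"] q by (simp add: U_def)
  have 2: "U powr (-s) = r powr q * A powr (-1)"
    using assms by (simp add: U_def powr_mult powr_powr)
  have 3: "A powr (1 + 1/s) * A powr (-1) = A powr (1/s)"
    using powr_add[of A "1 + 1/s" "-1"] by simp
  have "A powr (1 + 1/s) / s * w powr (-s) = A powr (1 + 1/s) / s * (t powr (-s) * U powr (-s))"
    using U t by (simp add: powr_mult)
  also have "\<dots> = r powr q * (A powr (1 + 1/s) * A powr (-1)) * (t powr (-s) / s)"
    unfolding 2 by (simp only: times_divide_eq_left times_divide_eq_right mult_ac)
  finally have 4: "A powr (1 + 1/s) / s * w powr (-s) = r powr q * A powr (1/s) * (t powr (-s) / s)"
    unfolding 3 .
  have "r\<^sup>2 * w = (r\<^sup>2 * U) * t" by (simp add: t(2) mult_ac)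
  then have "r\<^sup>2 * w + A powr (1 + 1/s) / s * w powr (-s)
      = (r powr q * A powr (1/s)) * (t + t powr (-s) / s)"
    unfolding 1 4 by (simp only: distrib_left)
  moreover have "(r powr q * A powr (1/s)) * (1 + 1/s) \<le> (r powr q * A powr (1/s)) * (t + t powr (-s) / s)"
    using add_powr_neg_ge[OF t(1) assms(3)] by (intro mult_left_mono) auto
  ultimately show ?thesis by (simp add: q_def mult.commute)
qed

text \<open>Extension to the endpoint values of \<open>v\<close>. For \<open>r > 0\<close> both make
  the right side infinite, through the penalty at 0, whose coefficient is positive, and through
  \<open>r^2 * v\<close> at infinity; for \<open>r = 0\<close> the left side is 0.\<close>

lemma potential_young:
  fixes r A s :: real and v :: ennreal
  assumes "r \<ge> 0" "A > 0" "s > 0"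
  shows "ennreal ((1 + 1/s) * (r powr (2 * s / (s+1)) * A powr (1/s)))
    \<le> ennreal (r\<^sup>2) * v + ennreal (A powr (1 + 1/s) / s) * ennreal_neg_powr v (-s)"
proof -
  consider "r = 0" | "r > 0" "v = 0" | "r > 0" "v = \<infinity>" | w where "r > 0" "v = ennreal w" "w > 0"
  proof (cases v rule: ennreal_cases)
    case (real w)
    then show ?thesis using that(1,2) that(4)[of w] assms(1) by (cases "r = 0"; cases "w = 0") auto
  next
    case top
    then show ?thesis using that(1,3) assms(1) by (cases "r = 0") auto
  qed
  then show ?thesis
  proof cases
    case 2
    have "A powr (1 + 1/s) / s > 0" using assms by simp
    then show ?thesis using 2 assms by (simp add: ennreal_neg_powr_def ennreal_mult_top)
  next
    case 3
    then show ?thesis by (simp add: ennreal_mult_top)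
  next
    case 4
    have "ennreal (r\<^sup>2) * v + ennreal (A powr (1 + 1/s) / s) * ennreal_neg_powr v (-s)
        = ennreal (r\<^sup>2 * w + A powr (1 + 1/s) / s * w powr (-s))"
      using 4 assms by (simp add: ennreal_neg_powr_def flip: ennreal_mult ennreal_plus)
    then show ?thesis
      using potential_young_real[OF 4(1) assms(2,3) 4(3)] by (simp only: ennreal_leI)
  qed simp
qed

lemma borel_measurable_ennreal_neg_powr [measurable]:
  "(\<lambda>v. ennreal_neg_powr v p) \<in> borel_measurable borel"
  unfolding ennreal_neg_powr_def by measurable

lemma powr_le_1_plus_sq:
  fixes r q :: real assumes "r \<ge> 0" "0 < q" "q \<le> 2" shows "r powr q \<le> 1 + r\<^sup>2"
proof (cases "r \<le> 1")
  case True
  then have "r powr q \<le> 1" using assms powr_mono2[of q r 1] by simp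
  then show ?thesis by (simp add: add_increasing2)
next
  case False
  then have "r powr q \<le> r powr 2" using assms by (intro powr_mono) auto
  then show ?thesis using False by simp
qed

text \<open>The power \<open>q\<close> of the norm rather than the norm, since \<open>q\<close> may
  lie below 1; the value \<open>0 powr q = 0\<close> is the intended one.\<close>

definition Lq_integral :: "'a::euclidean_space set \<Rightarrow> real \<Rightarrow> ('a \<Rightarrow> real) \<Rightarrow> real" where
  "Lq_integral \<Omega> q u = (LINT x|lebesgue_on \<Omega>. \<bar>u x\<bar> powr q)"

lemma Lq_integral_nonneg: "0 \<le> Lq_integral \<Omega> q u"
  by (simp add: Lq_integral_def)

lemma Lq_integrable:
  fixes u :: "'a::euclidean_space \<Rightarrow> real"
  assumes \<Omega>: "open \<Omega>" "bounded \<Omega>" and u: "L2_on \<Omega> u" and q: "0 < q" "q \<le> 2"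
  shows "integrable (lebesgue_on \<Omega>) (\<lambda>x. \<bar>u x\<bar> powr q)"
proof (rule Bochner_Integration.integrable_bound)
  interpret finite_measure "lebesgue_on \<Omega>" by (rule finite_measure_lebesgue_on[OF \<Omega>])
  note [measurable] = L2_on_measurable[OF u]
  show "integrable (lebesgue_on \<Omega>) (\<lambda>x. 1 + (norm (u x))\<^sup>2)" using L2_on_integrable[OF u] by simp
  show "(\<lambda>x. \<bar>u x\<bar> powr q) \<in> borel_measurable (lebesgue_on \<Omega>)" by measurable
  have "\<bar>u x\<bar> powr q \<le> 1 + (norm (u x))\<^sup>2" for x
    using powr_le_1_plus_sq[OF _ q, of "\<bar>u x\<bar>"] by simp
  then show "AE x in lebesgue_on \<Omega>. norm (\<bar>u x\<bar> powr q) \<le> norm (1 + (norm (u x))\<^sup>2)" by simp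
qed

lemma nn_integral_Lq:
  assumes \<Omega>: "open \<Omega>" "bounded \<Omega>" and u: "L2_on \<Omega> u" and q: "0 < q" "q \<le> 2"
  shows "(\<integral>\<^sup>+x. ennreal (\<bar>u x\<bar> powr q) \<partial>lebesgue_on \<Omega>) = ennreal (Lq_integral \<Omega> q u)"
  unfolding Lq_integral_def by (intro nn_integral_eq_integral Lq_integrable[OF assms]) auto

text \<open>Integrate the pointwise inequality with \<open>A\<close> the integral of
  \<open>|u|^q\<close>. The constraint turns the penalty into its coefficient \<open>\<mu>\<close>,
  and \<open>(1 + 1/s) * A^(1/s) * A = A^(1 + 1/s) + \<mu>\<close>, so the finite
  \<open>\<mu>\<close> cancels.\<close>

lemma potential_lower_bound:
  assumes \<Omega>: "open \<Omega>" "bounded \<Omega>" and u: "L2_on \<Omega> u" and s: "s > 0"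
    and V: "V \<in> admissible_potentials \<Omega> (-s)"
  shows "ennreal (Lq_integral \<Omega> (2 * s / (s+1)) u powr (1 + 1/s)) \<le> (\<integral>\<^sup>+x. ennreal ((u x)\<^sup>2) * V x \<partial>lebesgue_on \<Omega>)"
proof -
  define q where "q = 2 * s / (s+1)"
  have q: "0 < q" "q \<le> 2" using s by (simp_all add: q_def field_simps)
  define A where "A = Lq_integral \<Omega> q u"
  define X where "X = (\<integral>\<^sup>+x. ennreal ((u x)\<^sup>2) * V x \<partial>lebesgue_on \<Omega>)"
  note [measurable] = L2_on_measurable[OF u]
  have [measurable]: "V \<in> borel_measurable (lebesgue_on \<Omega>)"
    and V1: "(\<integral>\<^sup>+x. ennreal_neg_powr (V x) (-s) \<partial>lebesgue_on \<Omega>) = 1"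
    using V by (auto simp: admissible_potentials_def)
  have "ennreal (A powr (1 + 1/s)) \<le> X"
  proof (cases "A = 0")
    case False
    then have A: "A > 0" using Lq_integral_nonneg[of \<Omega> q u] by (simp add: A_def)
    define \<mu> where "\<mu> = A powr (1 + 1/s) / s"
    have \<mu>: "\<mu> \<ge> 0" using s by (simp add: \<mu>_def)
    have "ennreal (A powr (1 + 1/s) + \<mu>) = ennreal ((1 + 1/s) * A powr (1/s)) * ennreal A"
      using A s powr_add[of A 1 "1/s"] by (subst ennreal_mult[symmetric]) (auto simp: \<mu>_def field_simps)
    also have "\<dots> = (\<integral>\<^sup>+x. ennreal ((1 + 1/s) * A powr (1/s)) * ennreal (\<bar>u x\<bar> powr q) \<partial>lebesgue_on \<Omega>)"
      unfolding A_def nn_integral_Lq[OF \<Omega> u q, symmetric] by (rule nn_integral_cmult[symmetric]) measurable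
    also have "\<dots> \<le> (\<integral>\<^sup>+x. ennreal ((u x)\<^sup>2) * V x + ennreal \<mu> * ennreal_neg_powr (V x) (-s) \<partial>lebesgue_on \<Omega>)"
    proof (rule nn_integral_mono)
      fix x
      have "ennreal ((1 + 1/s) * A powr (1/s)) * ennreal (\<bar>u x\<bar> powr q)
          = ennreal ((1 + 1/s) * (\<bar>u x\<bar> powr q * A powr (1/s)))"
        using s by (subst ennreal_mult[symmetric]) (auto simp: algebra_simps)
      then show "ennreal ((1 + 1/s) * A powr (1/s)) * ennreal (\<bar>u x\<bar> powr q)
          \<le> ennreal ((u x)\<^sup>2) * V x + ennreal \<mu> * ennreal_neg_powr (V x) (-s)"
        using potential_young[OF abs_ge_zero[of "u x"] A s, of "V x"] by (simp add: q_def \<mu>_def)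
    qed
    also have "\<dots> = X + ennreal \<mu> * 1"
      unfolding X_def V1[symmetric] by (subst nn_integral_add) (auto intro!: nn_integral_cmult)
    finally have "ennreal (A powr (1 + 1/s) + \<mu>) \<le> X + ennreal \<mu>" by simp
    then show ?thesis
      using \<mu> by (cases X rule: ennreal_cases) (auto simp flip: ennreal_plus)
  qed simp
  then show ?thesis by (simp add: A_def X_def q_def)
qed

lemma measure_lebesgue_on_pos:
  assumes "open \<Omega>" "bounded \<Omega>" "\<Omega> \<noteq> {}"
  shows "emeasure (lebesgue_on \<Omega>) \<Omega> = ennreal (measure lebesgue \<Omega>)" "measure lebesgue \<Omega> > 0"
proof -
  have fin: "emeasure lebesgue \<Omega> < \<infinity>"
    using emeasure_bounded_finite[OF assms(2)] assms(1) by simp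
  have "emeasure (lebesgue_on \<Omega>) \<Omega> = emeasure lebesgue \<Omega>"
    using assms(1) by (intro emeasure_restrict_space) auto
  also have "\<dots> = ennreal (measure lebesgue \<Omega>)"
    using fin by (intro emeasure_eq_ennreal_measure) auto
  finally show "emeasure (lebesgue_on \<Omega>) \<Omega> = ennreal (measure lebesgue \<Omega>)" .
  have "\<not> negligible \<Omega>" using open_not_negligible[OF assms(1,3)] .
  then have "emeasure lebesgue \<Omega> \<noteq> 0"
    using assms(1) by (auto simp: negligible_iff_null_sets null_sets_def)
  then show "measure lebesgue \<Omega> > 0"
    using fin by (simp add: emeasure_eq_ennreal_measure zero_less_measure_iff)
qed

text \<open>The pointwise minimiser \<open>|u|^(-q/s) * A^(1/s)\<close> gives equality in the lower
  bound; its power \<open>-s\<close> is \<open>|u|^q / A\<close>, of integral 1.\<close>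

lemma optimal_potential:
  assumes \<Omega>: "open \<Omega>" "bounded \<Omega>" "\<Omega> \<noteq> {}" and u: "L2_on \<Omega> u" and s: "s > 0"
  obtains V where "V \<in> admissible_potentials \<Omega> (-s)"
    "(\<integral>\<^sup>+x. ennreal ((u x)\<^sup>2) * V x \<partial>lebesgue_on \<Omega>) = ennreal (Lq_integral \<Omega> (2 * s / (s+1)) u powr (1 + 1/s))"
proof -
  define q where "q = 2 * s / (s+1)"
  have q: "0 < q" "q \<le> 2" using s by (simp_all add: q_def field_simps)
  define A where "A = Lq_integral \<Omega> q u"
  note [measurable] = L2_on_measurable[OF u]
  have "\<exists>V\<in>admissible_potentials \<Omega> (-s).
      (\<integral>\<^sup>+x. ennreal ((u x)\<^sup>2) * V x \<partial>lebesgue_on \<Omega>) = ennreal (A powr (1 + 1/s))"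
  proof (cases "A = 0")
    case True
    define m where "m = measure lebesgue \<Omega>"
    note m = measure_lebesgue_on_pos[OF \<Omega>, folded m_def]
    \<comment> \<open>Here \<open>u = 0\<close> a.e., so the potential term is 0 for any choice and
      only the constraint matters: \<open>(m^(1/s))^(-s) = 1/m\<close>.\<close>
    define V where "V = (\<lambda>x::'a. ennreal (m powr (1/s)))"
    have pw: "m powr (1/s) \<noteq> 0" using m(2) by simp
    have "ennreal_neg_powr (ennreal (m powr (1/s))) (-s) = ennreal (1/m)"
      using m(2) s pw by (simp add: ennreal_neg_powr_def powr_powr powr_minus_divide)
    then have "(\<integral>\<^sup>+x. ennreal_neg_powr (V x) (-s) \<partial>lebesgue_on \<Omega>) = ennreal (1/m) * ennreal m"
      using \<Omega>(1) m(1) by (simp add: V_def)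
    also have "\<dots> = 1" using m(2) by (simp flip: ennreal_mult)
    finally have "V \<in> admissible_potentials \<Omega> (-s)" by (simp add: admissible_potentials_def V_def)
    moreover have "(\<integral>\<^sup>+x. ennreal ((u x)\<^sup>2) * V x \<partial>lebesgue_on \<Omega>) = 0"
    proof -
      have "AE x in lebesgue_on \<Omega>. \<bar>u x\<bar> powr q = 0"
        using True integral_nonneg_eq_0_iff_AE[OF Lq_integrable[OF \<Omega>(1,2) u q]]
        by (simp add: A_def Lq_integral_def)
      then have "AE x in lebesgue_on \<Omega>. ennreal ((u x)\<^sup>2) * V x = 0"
        by eventually_elim simp
      then show ?thesis by (subst nn_integral_0_iff_AE) (auto simp: V_def)
    qed
    ultimately show ?thesis using True by (intro bexI[of _ V]) auto
  next
    case False
    then have A: "A > 0" using Lq_integral_nonneg[of \<Omega> q u] by (simp add: A_def)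
    \<comment> \<open>At zeros of \<open>u\<close> the conventions give
      \<open>0 * infinity = 0\<close> in the energy and power 0 in the constraint, so the value
      infinity costs nothing in either integral.\<close>
    define V where "V x = (if u x = 0 then \<infinity> else ennreal (\<bar>u x\<bar> powr (-q/s) * A powr (1/s)))" for x
    have [measurable]: "V \<in> borel_measurable (lebesgue_on \<Omega>)" unfolding V_def by measurable
    have qs: "2 + - q / s = q" unfolding q_def by (rule exponent_identity[OF s])
    have 1: "ennreal_neg_powr (V x) (-s) = ennreal (1/A) * ennreal (\<bar>u x\<bar> powr q)" for x
    proof (cases "u x = 0")
      case False
      have "(\<bar>u x\<bar> powr (-q/s) * A powr (1/s)) powr (-s) = 1/A * \<bar>u x\<bar> powr q"
        using A s by (simp only: powr_mult powr_powr) (simp add: powr_minus_divide)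
      then show ?thesis
        using False A by (simp add: V_def ennreal_neg_powr_def flip: ennreal_mult)
    qed (simp add: V_def ennreal_neg_powr_def)
    have 2: "ennreal ((u x)\<^sup>2) * V x = ennreal (A powr (1/s)) * ennreal (\<bar>u x\<bar> powr q)" for x
    proof (cases "u x = 0")
      case False
      then have "\<bar>u x\<bar>\<^sup>2 * \<bar>u x\<bar> powr (-q/s) = \<bar>u x\<bar> powr q"
        using powr_add[of "\<bar>u x\<bar>" 2 "-q/s"] qs by simp
      then have "(u x)\<^sup>2 * (\<bar>u x\<bar> powr (-q/s) * A powr (1/s)) = A powr (1/s) * \<bar>u x\<bar> powr q"
        by (simp add: algebra_simps)
      then show ?thesis using False by (simp add: V_def flip: ennreal_mult)
    qed (simp add: V_def)
    have "(\<integral>\<^sup>+x. ennreal_neg_powr (V x) (-s) \<partial>lebesgue_on \<Omega>) = ennreal (1/A) * ennreal A"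
      unfolding 1 A_def nn_integral_Lq[OF \<Omega>(1,2) u q, symmetric] by (rule nn_integral_cmult) measurable
    also have "\<dots> = 1" using A by (simp flip: ennreal_mult)
    finally have "V \<in> admissible_potentials \<Omega> (-s)" by (simp add: admissible_potentials_def)
    moreover have "(\<integral>\<^sup>+x. ennreal ((u x)\<^sup>2) * V x \<partial>lebesgue_on \<Omega>) = ennreal (A powr (1/s)) * ennreal A"
      unfolding 2 A_def nn_integral_Lq[OF \<Omega>(1,2) u q, symmetric] by (rule nn_integral_cmult) measurable
    moreover have "ennreal (A powr (1/s)) * ennreal A = ennreal (A powr (1 + 1/s))"
      using A by (simp add: powr_add mult.commute flip: ennreal_mult)
    ultimately show ?thesis by (intro bexI[of _ V]) auto
  qed
  then show thesis using that by (auto simp: A_def q_def)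
qed

section \<open>The direct method for the reduced energy\<close>

lemma Lq_integral_fatou:
  assumes \<Omega>: "open \<Omega>" "bounded \<Omega>" and v: "\<And>n. L2_on \<Omega> (v n)" and u: "L2_on \<Omega> u" and q: "0 < q" "q \<le> 2"
    and AE: "AE x in lebesgue_on \<Omega>. (\<lambda>n. v n x) \<longlonglongrightarrow> u x" and lim: "(\<lambda>n. Lq_integral \<Omega> q (v n)) \<longlonglongrightarrow> l"
  shows "Lq_integral \<Omega> q u \<le> l"
proof -
  note [measurable] = L2_on_measurable[OF v] L2_on_measurable[OF u]
  have l: "l \<ge> 0" by (rule LIMSEQ_le_const[OF lim]) (simp add: Lq_integral_nonneg)
  have "ennreal (Lq_integral \<Omega> q u) = (\<integral>\<^sup>+x. ennreal (\<bar>u x\<bar> powr q) \<partial>lebesgue_on \<Omega>)"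
    by (rule nn_integral_Lq[OF \<Omega> u q, symmetric])
  also have "\<dots> = (\<integral>\<^sup>+x. liminf (\<lambda>n. ennreal (\<bar>v n x\<bar> powr q)) \<partial>lebesgue_on \<Omega>)"
  proof (rule nn_integral_cong_AE, use AE in eventually_elim)
    fix x assume "(\<lambda>n. v n x) \<longlonglongrightarrow> u x"
    \<comment> \<open>Positivity of \<open>q\<close> gives continuity of the power also where
      \<open>u x = 0\<close>.\<close>
    then have "(\<lambda>n. ennreal (\<bar>v n x\<bar> powr q)) \<longlonglongrightarrow> ennreal (\<bar>u x\<bar> powr q)"
      using q by (intro tendsto_ennrealI tendsto_powr' tendsto_rabs tendsto_const) auto
    then show "ennreal (\<bar>u x\<bar> powr q) = liminf (\<lambda>n. ennreal (\<bar>v n x\<bar> powr q))"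
      by (metis lim_imp_Liminf sequentially_bot)
  qed
  also have "\<dots> \<le> liminf (\<lambda>n. \<integral>\<^sup>+x. ennreal (\<bar>v n x\<bar> powr q) \<partial>lebesgue_on \<Omega>)"
    by (intro nn_integral_liminf) measurable
  also have "\<dots> = liminf (\<lambda>n. ennreal (Lq_integral \<Omega> q (v n)))"
    by (simp add: nn_integral_Lq[OF \<Omega> v q])
  also have "\<dots> = ennreal l"
    using lim by (intro lim_imp_Liminf tendsto_ennrealI) auto
  finally show ?thesis using l by (simp add: ennreal_le_iff)
qed

text \<open>The energy left after minimising over the potential for fixed \<open>u\<close>.\<close>

definition reduced_energy ::
    "'a::euclidean_space set \<Rightarrow> ('a \<Rightarrow> real) \<Rightarrow> real \<Rightarrow> ('a \<Rightarrow> real) \<Rightarrow> ('a \<Rightarrow> 'a) \<Rightarrow> real" where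
  "reduced_energy \<Omega> f s u Du = 1/2 * sqnorm \<Omega> Du + 1/2 * Lq_integral \<Omega> (2 * s / (s+1)) u powr (1 + 1/s)
     - (LINT x|lebesgue_on \<Omega>. u x * f x)"

lemma energy_functional_eq:
  assumes "(\<integral>\<^sup>+x. ennreal ((u x)\<^sup>2) * V x \<partial>lebesgue_on \<Omega>) = ennreal a" "a \<ge> 0"
  shows "energy_functional \<Omega> f V u Du =
    ereal (1/2 * sqnorm \<Omega> Du + 1/2 * a - (LINT x|lebesgue_on \<Omega>. u x * f x))"
  using assms by (simp add: energy_functional_def sqnorm_def enn2ereal_ennreal)

text \<open>An infinite potential term makes the energy infinite, so only the finite case calls on
  the lower bound.\<close>

lemma reduced_energy_le:
  assumes \<Omega>: "open \<Omega>" "bounded \<Omega>" and u: "L2_on \<Omega> u" and s: "s > 0"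
    and V: "V \<in> admissible_potentials \<Omega> (-s)"
  shows "ereal (reduced_energy \<Omega> f s u Du) \<le> energy_functional \<Omega> f V u Du"
proof -
  note le = potential_lower_bound[OF assms]
  show ?thesis
  proof (cases "\<integral>\<^sup>+x. ennreal ((u x)\<^sup>2) * V x \<partial>lebesgue_on \<Omega>" rule: ennreal_cases)
    case (real a)
    then show ?thesis using le
      unfolding energy_functional_eq[OF real(2,1)] reduced_energy_def by simp
  next
    case top
    then show ?thesis by (simp add: energy_functional_def)
  qed
qed

text \<open>Convergence of the middle term is obtained by subtraction: once the gradient norms
  converge along a subsequence, it is determined by quantities that all converge, and Fatou's lemma
  compares its limit with the value at \<open>u\<close>. Of \<open>G\<close> only
  \<open>sqnorm \<Omega> G <= D\<close> is required.\<close>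

lemma reduced_energy_minimizer:
  fixes \<Omega> :: "'a::euclidean_space set"
  assumes \<Omega>: "open \<Omega>" "bounded \<Omega>" and f: "L2_on \<Omega> f" and s: "s > 0"
  obtains u G where "(u, G) \<in> H10 \<Omega>"
    "\<And>v Dv. (v, Dv) \<in> H10 \<Omega> \<Longrightarrow> reduced_energy \<Omega> f s u G \<le> reduced_energy \<Omega> f s v Dv"
proof -
  define q where "q = 2 * s / (s+1)"
  have q: "0 < q" "q \<le> 2" using s by (simp_all add: q_def field_simps)
  let ?J = "reduced_energy \<Omega> f s"
  obtain C where C: "C > 0" "\<And>u Du. (u, Du) \<in> H10 \<Omega> \<Longrightarrow> sqnorm \<Omega> u \<le> C * sqnorm \<Omega> Du"
    by (rule H10_poincare[OF \<Omega>]) blast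
  \<comment> \<open>Young's parameter \<open>1/(4*C)\<close> lets the Poincare inequality absorb the
    linear term into \<open>1/4\<close> of the gradient norm, half of what is available; the
    nonnegative middle term is dropped.\<close>
  have coercive: "1/4 * sqnorm \<Omega> Du - 4 * C * sqnorm \<Omega> f \<le> ?J u Du" if u: "(u, Du) \<in> H10 \<Omega>" for u Du
  proof -
    have "\<bar>LINT x|lebesgue_on \<Omega>. u x * f x\<bar> \<le> 1/(4*C) * sqnorm \<Omega> u + sqnorm \<Omega> f / (1/(4*C))"
      using L2_on_integral_inner_le[OF H10_D(1)[OF u] f, of "1/(4*C)"] C(1) by simp
    also have "1/(4*C) * sqnorm \<Omega> u \<le> 1/(4*C) * (C * sqnorm \<Omega> Du)"
      using C by (intro mult_left_mono C(2)[OF u]) auto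
    finally have "\<bar>LINT x|lebesgue_on \<Omega>. u x * f x\<bar> \<le> 1/4 * sqnorm \<Omega> Du + 4 * C * sqnorm \<Omega> f"
      using C(1) by (simp add: mult.commute)
    moreover have "0 \<le> Lq_integral \<Omega> (2 * s / (s+1)) u powr (1 + 1/s)" by simp
    ultimately show ?thesis unfolding reduced_energy_def by linarith
  qed
  define m where "m = (INF (u, Du)\<in>H10 \<Omega>. ?J u Du)"
  have bdd: "bdd_below ((\<lambda>(u, Du). ?J u Du) ` H10 \<Omega>)"
  proof (rule bdd_belowI)
    fix y assume "y \<in> (\<lambda>(u, Du). ?J u Du) ` H10 \<Omega>"
    then obtain u Du where u: "(u, Du) \<in> H10 \<Omega>" "y = ?J u Du" by auto
    then show "- (4 * C * sqnorm \<Omega> f) \<le> y" using coercive[OF u(1)] sqnorm_nonneg[of \<Omega> Du] by simp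
  qed
  have ne: "H10 \<Omega> \<noteq> {}" using H10_zero by blast
  have m_le: "m \<le> ?J u Du" if "(u, Du) \<in> H10 \<Omega>" for u Du
    unfolding m_def using cINF_lower[OF bdd that] by simp
  have "\<exists>u Du. (u, Du) \<in> H10 \<Omega> \<and> ?J u Du < m + inverse (real (Suc n))" for n
    using cINF_less_iff[OF ne bdd, of "m + inverse (real (Suc n))"] unfolding m_def by force
  then obtain v Dv where v: "\<And>n. (v n, Dv n) \<in> H10 \<Omega>" "\<And>n. ?J (v n) (Dv n) < m + inverse (real (Suc n))"
    by metis
  note vD = H10_D[OF v(1)]
  have J_lim: "(\<lambda>n. ?J (v n) (Dv n)) \<longlonglongrightarrow> m"
  proof (rule tendsto_sandwich[OF _ _ tendsto_const])
    show "\<forall>\<^sub>F n in sequentially. m \<le> ?J (v n) (Dv n)" using m_le[OF v(1)] by simp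
    show "\<forall>\<^sub>F n in sequentially. ?J (v n) (Dv n) \<le> m + inverse (real (Suc n))"
      using v(2) by (intro always_eventually allI less_imp_le)
    show "(\<lambda>n. m + inverse (real (Suc n))) \<longlonglongrightarrow> m" by (rule LIMSEQ_inverse_real_of_nat_add)
  qed
  define M where "M = 4 * (m + 1 + 4 * C * sqnorm \<Omega> f)"
  have M: "sqnorm \<Omega> (Dv n) \<le> M" for n
  proof -
    have "inverse (real (Suc n)) \<le> 1" by (simp add: inverse_eq_divide)
    then show ?thesis using coercive[OF v(1)[of n]] v(2)[of n] by (simp add: M_def)
  qed
  obtain k u where u: "strict_mono (k::nat\<Rightarrow>nat)" "L2_on \<Omega> u"
    "(\<lambda>n. sqnorm \<Omega> (\<lambda>x. v (k n) x - u x)) \<longlonglongrightarrow> 0"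
    "AE x in lebesgue_on \<Omega>. (\<lambda>n. v (k n) x) \<longlonglongrightarrow> u x"
    by (rule H10_rellich[of \<Omega> v Dv, OF \<Omega> v(1) M]) blast
  have "\<exists>l h. strict_mono (h::nat\<Rightarrow>nat) \<and> ((\<lambda>n. sqnorm \<Omega> (Dv (k n))) \<circ> h) \<longlonglongrightarrow> l"
    using M sqnorm_nonneg[of \<Omega>] compact_Icc[of 0 M]
    unfolding compact_eq_seq_compact_metric seq_compact_def by (metis atLeastAtMost_iff)
  then obtain D h where h: "strict_mono (h::nat\<Rightarrow>nat)" "(\<lambda>n. sqnorm \<Omega> (Dv (k (h n)))) \<longlonglongrightarrow> D"
    by (auto simp: o_def)
  define j where "j n = k (h n)" for n
  have j: "strict_mono j" using strict_mono_o[OF u(1) h(1)] by (simp add: j_def[abs_def] o_def)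
  have lim_v: "(\<lambda>n. sqnorm \<Omega> (\<lambda>x. v (j n) x - u x)) \<longlonglongrightarrow> 0"
    using LIMSEQ_subseq_LIMSEQ[OF u(3) h(1)] by (simp add: o_def j_def)
  have AE_v: "AE x in lebesgue_on \<Omega>. (\<lambda>n. v (j n) x) \<longlonglongrightarrow> u x"
    using u(4)
  proof eventually_elim
    fix x assume "(\<lambda>n. v (k n) x) \<longlonglongrightarrow> u x"
    from LIMSEQ_subseq_LIMSEQ[OF this h(1)] show "(\<lambda>n. v (j n) x) \<longlonglongrightarrow> u x" by (simp add: o_def j_def)
  qed
  have D_lim: "(\<lambda>n. sqnorm \<Omega> (Dv (j n))) \<longlonglongrightarrow> D" using h(2) by (simp add: j_def)
  obtain G where G: "(u, G) \<in> H10 \<Omega>" "sqnorm \<Omega> G \<le> D"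
    by (rule H10_gradient_lsc[of \<Omega> "\<lambda>n. v (j n)" "\<lambda>n. Dv (j n)", OF \<Omega> v(1) u(2) lim_v D_lim]) blast
  have F_lim: "(\<lambda>n. LINT x|lebesgue_on \<Omega>. v (j n) x * f x) \<longlonglongrightarrow> (LINT x|lebesgue_on \<Omega>. u x * f x)"
    using L2_on_integral_inner_tendsto[of \<Omega> "\<lambda>n. v (j n)", OF vD(1) u(2) f lim_v] by simp
  define A where "A n = Lq_integral \<Omega> q (v (j n))" for n
  have A0: "A n \<ge> 0" for n by (simp add: A_def Lq_integral_nonneg)
  \<comment> \<open>The limit forced on the middle term by convergence of the total, the gradient
    term and the linear term.\<close>
  define T where "T = 2 * (m - 1/2 * D + (LINT x|lebesgue_on \<Omega>. u x * f x))"
  have "A n powr (1 + 1/s)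
      = 2 * (?J (v (j n)) (Dv (j n)) - 1/2 * sqnorm \<Omega> (Dv (j n)) + (LINT x|lebesgue_on \<Omega>. v (j n) x * f x))" for n
    by (simp add: reduced_energy_def A_def q_def)
  moreover have "(\<lambda>n. ?J (v (j n)) (Dv (j n))) \<longlonglongrightarrow> m"
    using LIMSEQ_subseq_LIMSEQ[OF J_lim j] by (simp add: o_def)
  ultimately have T_lim: "(\<lambda>n. A n powr (1 + 1/s)) \<longlonglongrightarrow> T"
    unfolding T_def using D_lim F_lim by (simp only:) (intro tendsto_intros)
  have T0: "T \<ge> 0" by (rule LIMSEQ_le_const[OF T_lim]) simp
  \<comment> \<open>The inverse of \<open>1 + 1/s\<close>, equal to \<open>q/2\<close>; it passes
    from convergence of the powers of \<open>A n\<close> to convergence of \<open>A n\<close>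
    itself, to which Fatou's lemma applies.\<close>
  define \<theta> where "\<theta> = s / (s + 1)"
  have \<theta>: "\<theta> > 0" "(1 + 1/s) * \<theta> = 1" using s by (simp_all add: \<theta>_def add_divide_distrib[symmetric] field_simps add_pos_pos less_imp_neq[symmetric])
  have "(\<lambda>n. (A n powr (1 + 1/s)) powr \<theta>) \<longlonglongrightarrow> T powr \<theta>"
    using \<theta>(1) by (intro tendsto_powr' T_lim tendsto_const) auto
  then have "A \<longlonglongrightarrow> T powr \<theta>" using A0 by (simp add: powr_powr \<theta>(2))
  then have "Lq_integral \<Omega> q u \<le> T powr \<theta>"
    unfolding A_def by (rule Lq_integral_fatou[OF \<Omega> vD(1) u(2) q AE_v])
  then have "Lq_integral \<Omega> q u powr (1 + 1/s) \<le> (T powr \<theta>) powr (1 + 1/s)"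
    using s by (intro powr_mono2 Lq_integral_nonneg) auto
  also have "\<dots> = T" using T0 \<theta>(2) by (simp add: powr_powr mult.commute)
  finally have "?J u G \<le> m"
    using G(2) unfolding reduced_energy_def T_def q_def by simp
  then show thesis using m_le by (intro that[OF G(1)]) (meson order_trans)
qed

theorem proposition4p2:
  fixes \<Omega> :: "'a::euclidean_space set" and f :: "'a \<Rightarrow> real" and p :: real
  assumes "open \<Omega>" and "bounded \<Omega>" and "\<Omega> \<noteq> {}"
    and "L2_on \<Omega> f"
    and "p < 0"
  shows "\<exists>V\<in>admissible_potentials \<Omega> p.
           \<forall>W\<in>admissible_potentials \<Omega> p. dirichlet_energy \<Omega> f V \<le> dirichlet_energy \<Omega> f W"
proof -
  define s where "s = - p"
  have s: "s > 0" and p: "p = - s" using assms(5) by (auto simp: s_def)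
  obtain u G where u: "(u, G) \<in> H10 \<Omega>"
    and min: "\<And>v Dv. (v, Dv) \<in> H10 \<Omega> \<Longrightarrow> reduced_energy \<Omega> f s u G \<le> reduced_energy \<Omega> f s v Dv"
    by (rule reduced_energy_minimizer[OF assms(1,2,4) s]) blast
  obtain V where V: "V \<in> admissible_potentials \<Omega> (-s)"
    "(\<integral>\<^sup>+x. ennreal ((u x)\<^sup>2) * V x \<partial>lebesgue_on \<Omega>) = ennreal (Lq_integral \<Omega> (2 * s / (s+1)) u powr (1 + 1/s))"
    by (rule optimal_potential[OF assms(1-3) H10_D(1)[OF u] s])
  \<comment> \<open>Testing with \<open>u\<close> alone suffices: for any admissible
    \<open>W\<close>, the energy at each \<open>v\<close> is at least the reduced energy of
    \<open>v\<close>, hence at least that of \<open>u\<close>.\<close>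
  have "dirichlet_energy \<Omega> f V \<le> energy_functional \<Omega> f V u G"
    unfolding dirichlet_energy_def using INF_lower[OF u, of "\<lambda>(u, Du). energy_functional \<Omega> f V u Du"] by simp
  also have "\<dots> = ereal (reduced_energy \<Omega> f s u G)"
    using energy_functional_eq[OF V(2)] by (simp add: reduced_energy_def)
  finally have V_le: "dirichlet_energy \<Omega> f V \<le> ereal (reduced_energy \<Omega> f s u G)" .
  have "dirichlet_energy \<Omega> f V \<le> dirichlet_energy \<Omega> f W" if W: "W \<in> admissible_potentials \<Omega> (-s)" for W
    unfolding dirichlet_energy_def[of \<Omega> f W]
  proof (rule INF_greatest, clarify)
    fix v Dv assume v: "(v, Dv) \<in> H10 \<Omega>"
    have "dirichlet_energy \<Omega> f V \<le> ereal (reduced_energy \<Omega> f s v Dv)"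
      using V_le min[OF v] by (meson ereal_less_eq(3) order_trans)
    also have "\<dots> \<le> energy_functional \<Omega> f W v Dv"
      by (rule reduced_energy_le[OF assms(1,2) H10_D(1)[OF v] s W])
    finally show "dirichlet_energy \<Omega> f V \<le> energy_functional \<Omega> f W v Dv" .
  qed
  then show ?thesis using V(1) unfolding p by blast
qed

end
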